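(* Let $\mu \in \mathbb{R}_{\geq 1}$, let $m > n \geq 3$ and $N>0$ be integers, let $\delta \in (1/4,1)$, $c=(\delta-1/4)^{-1}$ and $\varepsilon \in (0,1)$ be such that $$\log(N\varepsilon) > \frac{mn}{2}\log(c) + n(n+2)\log(\mu) + n\log(3n^2) + 1,$$ where $\log$ is the base-$2$ logarithm. Then for every $\mathfrak{B} \in \Omega(n,m,\mu)$, Algorithm II with $\delta$-LLL succeeds on at least $(1-\varepsilon)N^n$ of the $N^n$ vectors $a \in (\mathbb{Z}/N\mathbb{Z})^n$ (i.e. on at least a $(1-\varepsilon)$-fraction of the hidden lattice problems $\mathcal{H}(\mathfrak{B})=\{F_\mathfrak{B}(a) : a \in (\mathbb{Z}/N\mathbb{Z})^n\}$), whichever $\delta$-LLL-reduced basis is used in the algorithm.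
   Context: For a finite family $\mathfrak{B}=\{v_1,\dots,v_n\}\subseteq\mathbb{Z}^m$ its size is $\sigma(\mathfrak{B})=\sqrt{\frac1n\sum_i\|v_i\|^2}$ (Euclidean norm). $\Omega(n,m,\mu)$ is the set of families $\mathfrak{B}=\{v_1,\dots,v_n\}$ of vectors in $\mathbb{Z}^m$ whose reductions modulo $N$ are linearly independent over $\mathbb{Z}/N\mathbb{Z}$ and with $\sigma(\mathfrak{B})\le\mu$; $\mathcal{L}(\mathfrak{B})$ is the lattice generated by $\mathfrak{B}$. For a lattice $\Lambda\subseteq\mathbb{Z}^m$, its completion is $\overline{\Lambda}=\Lambda_{\mathbb{Q}}\cap\mathbb{Z}^m$ ($\Lambda_{\mathbb{Q}}$ the $\mathbb{Q}$-span). Let $\pi_N:\mathbb{Z}^m\to(\mathbb{Z}/N\mathbb{Z})^m$ be reduction mod $N$. For $a=(a_i)\in(\mathbb{Z}/N\mathbb{Z})^n$ put $F_\mathfrak{B}(a)=\sum_i a_i\pi_N(v_i)$ and define the congruence lattice $\mathcal{M}(a)_N=\{v\in\mathbb{Z}^m:\pi_N(v)\in\mathbb{Z}F_\mathfrak{B}(a)\}$ (a lattice of rank $m$). A basis is $\delta$-LLL-reduced if it is LLL-reduced with parameter $\delta$ in the sense of Lenstra–Lenstra–Lovász. Algorithm II with $\delta$-LLL on input $a$: take a $\delta$-LLL-reduced basis $u_1,\dots,u_m$ of $\mathcal{M}(a)_N$, reorder it by nondecreasing Euclidean norm, let $\mathcal{N}_{\rm II}=\bigoplus_{i=1}^{n}\mathbb{Z}u_i$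 and output $\overline{\mathcal{N}_{\rm II}}$; it succeeds if $\overline{\mathcal{N}_{\rm II}}=\overline{\mathcal{L}(\mathfrak{B})}$. *)

theory Defs
  imports "HOL-Analysis.Analysis" "HOL-Number_Theory.Cong"
begin

text \<open>
  The ambient lattice is \<open>int ^ 'm\<close>, so the ambient dimension is \<open>CARD('m)\<close>. A family of \<open>k\<close>
  vectors is a function on \<open>nat\<close> of which only the values at indices below \<open>k\<close> matter.
  A residue class modulo \<open>N\<close> is given by its representative in \<open>{0..<N}\<close>.
\<close>

definition real_vec :: "int ^ 'm \<Rightarrow> real ^ 'm" where
  "real_vec w = (\<chi> j. real_of_int (w $ j))"

definition rat_vec :: "int ^ 'm \<Rightarrow> rat ^ 'm" where
  "rat_vec w = (\<chi> j. rat_of_int (w $ j))"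

definition family_size :: "nat \<Rightarrow> (nat \<Rightarrow> int ^ 'm) \<Rightarrow> real" where
  "family_size n v = sqrt (1 / real n * (\<Sum>i<n. (norm (real_vec (v i)))\<^sup>2))"

definition lin_indep_mod :: "int \<Rightarrow> nat \<Rightarrow> (nat \<Rightarrow> int ^ 'm) \<Rightarrow> bool" where
  "lin_indep_mod N n v \<longleftrightarrow>
     (\<forall>x :: nat \<Rightarrow> int. (\<forall>j. [(\<Sum>i<n. x i * v i $ j) = 0] (mod N))
        \<longrightarrow> (\<forall>i<n. [x i = 0] (mod N)))"

definition Omega_families :: "int \<Rightarrow> nat \<Rightarrow> real \<Rightarrow> (nat \<Rightarrow> int ^ 'm) set" where
  "Omega_families N n \<mu> = {v. lin_indep_mod N n v \<and> family_size n v \<le> \<mu>}"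

definition lattice_gen :: "nat \<Rightarrow> (nat \<Rightarrow> int ^ 'm) \<Rightarrow> (int ^ 'm) set" where
  "lattice_gen k u = {(\<Sum>i<k. x i *s u i) | x :: nat \<Rightarrow> int. True}"

definition lattice_basis :: "nat \<Rightarrow> (nat \<Rightarrow> int ^ 'm) \<Rightarrow> (int ^ 'm) set \<Rightarrow> bool" where
  "lattice_basis k u L \<longleftrightarrow>
     lattice_gen k u = L \<and>
     (\<forall>x :: nat \<Rightarrow> int. (\<Sum>i<k. x i *s u i) = 0 \<longrightarrow> (\<forall>i<k. x i = 0))"

definition lattice_completion :: "(int ^ 'm) set \<Rightarrow> (int ^ 'm) set" where
  "lattice_completion L = {w. rat_vec w \<in> vec.span (rat_vec ` L)}"

definition coeff_vectors :: "int \<Rightarrow> nat \<Rightarrow> (nat \<Rightarrow> int) set" where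
  "coeff_vectors N n = {..<n} \<rightarrow>\<^sub>E {0..<N}"

definition hidden_vec :: "int \<Rightarrow> nat \<Rightarrow> (nat \<Rightarrow> int ^ 'm) \<Rightarrow> (nat \<Rightarrow> int) \<Rightarrow> int ^ 'm" where
  "hidden_vec N n v a = (\<chi> j. (\<Sum>i<n. a i * v i $ j) mod N)"

definition hidden_lattice_problems :: "int \<Rightarrow> nat \<Rightarrow> (nat \<Rightarrow> int ^ 'm) \<Rightarrow> (int ^ 'm) set" where
  "hidden_lattice_problems N n v = hidden_vec N n v ` coeff_vectors N n"

definition congruence_lattice :: "int \<Rightarrow> int ^ 'm \<Rightarrow> (int ^ 'm) set" where
  "congruence_lattice N b = {w. \<exists>k :: int. \<forall>j. [w $ j = k * b $ j] (mod N)}"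

fun gso :: "(nat \<Rightarrow> 'a :: real_inner) \<Rightarrow> nat \<Rightarrow> 'a" where
  "gso b i = b i - (\<Sum>j<i. (b i \<bullet> gso b j / (gso b j \<bullet> gso b j)) *\<^sub>R gso b j)"

declare gso.simps [simp del]

definition gso_coeff :: "(nat \<Rightarrow> 'a :: real_inner) \<Rightarrow> nat \<Rightarrow> nat \<Rightarrow> real" where
  "gso_coeff b i j = b i \<bullet> gso b j / (gso b j \<bullet> gso b j)"

definition lll_reduced :: "real \<Rightarrow> nat \<Rightarrow> (nat \<Rightarrow> 'a :: real_inner) \<Rightarrow> bool" where
  "lll_reduced \<delta> k b \<longleftrightarrow>
     (\<forall>i<k. \<forall>j<i. \<bar>gso_coeff b i j\<bar> \<le> 1 / 2) \<and>
     (\<forall>i. Suc i < k \<longrightarrow>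
        (norm (gso b (Suc i) + gso_coeff b (Suc i) i *\<^sub>R gso b i))\<^sup>2 \<ge> \<delta> * (norm (gso b i))\<^sup>2)"

definition lll_reduced_basis :: "real \<Rightarrow> (nat \<Rightarrow> int ^ 'm) \<Rightarrow> (int ^ 'm) set \<Rightarrow> bool" where
  "lll_reduced_basis \<delta> u L \<longleftrightarrow>
     lattice_basis CARD('m) u L \<and> lll_reduced \<delta> CARD('m) (\<lambda>i. real_vec (u i))"

text \<open>
  The algorithm leaves open which reduced basis \<open>u\<close> is taken, and, if there are vectors of equal
  norm, which sorting permutation \<open>p\<close>. Its possible outputs are therefore a set; success means
  that every possible output is the completion of the hidden lattice.
\<close>

definition algII_outputs :: "real \<Rightarrow> int \<Rightarrow> nat \<Rightarrow> int ^ 'm \<Rightarrow> (int ^ 'm) set set" where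
  "algII_outputs \<delta> N n b =
     {lattice_completion (lattice_gen n (u \<circ> p)) | u p.
        lll_reduced_basis \<delta> u (congruence_lattice N b) \<and>
        p permutes {..<CARD('m)} \<and>
        mono_on {..<CARD('m)} (\<lambda>i. norm (real_vec (u (p i))))}"

definition algII_succeeds :: "real \<Rightarrow> int \<Rightarrow> nat \<Rightarrow> (nat \<Rightarrow> int ^ 'm) \<Rightarrow> int ^ 'm \<Rightarrow> bool" where
  "algII_succeeds \<delta> N n v b \<longleftrightarrow>
     (\<forall>M \<in> algII_outputs \<delta> N n b. M = lattice_completion (lattice_gen n v))"

end

theory Submission
  imports Defs "Jordan_Normal_Form.Determinant"
begin

no_notation Matrix.vec_index (infixl "$" 100)

text \<open>
  Let \<open>b\<close> be the hidden vector \<open>\<Sum> a\<^sub>i v\<^sub>i\<close> modulo \<open>N\<close>. A vector \<open>u\<close> of the congruence lattice is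
  \<open>k b + N u'\<close> with \<open>u'\<close> integral, so if \<open>u\<close> is outside the span of the \<open>v\<^sub>i\<close>, its distance to that span is
  \<open>N\<close> times the distance of \<open>u'\<close>; as the Gram determinant of \<open>v\<^sub>1, \<dots>, v\<^sub>n, u'\<close> is a positive integer, this
  forces \<open>\<parallel>u\<parallel> \<mu>\<^sup>n \<ge> N\<close>. It therefore suffices that the first \<open>n\<close> vectors of a reduced basis are shorter
  than \<open>N / \<mu>\<^sup>n\<close>.

  The congruence lattice contains all \<open>\<Sum> x\<^sub>i v\<^sub>i\<close> with \<open>x\<close> in \<open>\<int>a + N\<int>\<^sup>n\<close>. If every nonzero integer
  vector \<open>y\<close> with \<open>\<langle>a, y\<rangle> \<equiv> 0\<close> modulo \<open>N\<close> has sup norm above \<open>r\<close>, then by a Fourier-analytic transference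
  argument the vectors of \<open>\<int>a + N\<int>\<^sup>n\<close> of length \<open>n\<^sup>3\<^sup>/\<^sup>2 N / r\<close> lie in no hyperplane, and the
  reduction inequalities bound the first \<open>n\<close> basis vectors in terms of them. Finally, a union bound
  over \<open>y\<close>, grouped by \<open>d = gcd(y, N)\<close> and using \<open>\<Sum> d\<^sup>1\<^sup>-\<^sup>n \<le> 2\<close> for \<open>n \<ge> 3\<close>, shows that such short
  \<open>y\<close> exist for at most \<open>2 (3 r)\<^sup>n N\<^sup>n\<^sup>-\<^sup>1\<close> of the vectors \<open>a\<close>.
\<close>

section \<open>Gram determinants of integer vectors\<close>

text \<open>This is the independence clause of \<open>lattice_basis\<close>, kept over the integers
  so that Gram determinants stay integral; clearing denominators later turns it into rational
  independence.\<close>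

definition int_independent :: "nat \<Rightarrow> (nat \<Rightarrow> int ^ 'm) \<Rightarrow> bool" where
  "int_independent k b \<longleftrightarrow>
     (\<forall>x :: nat \<Rightarrow> int. (\<Sum>i<k. x i *s b i) = 0 \<longrightarrow> (\<forall>i<k. x i = 0))"

section \<open>Gram-Schmidt orthogonalisation and the Gram determinant\<close>

lemma gso_decomp: "b i = gso b i + (\<Sum>j<i. gso_coeff b i j *\<^sub>R gso b j)"
  by (subst gso.simps) (simp add: gso_coeff_def)

lemma gso_orthogonal_less: "j < i \<Longrightarrow> gso b i \<bullet> gso b j = 0"
proof (induction i arbitrary: j rule: less_induct)
  case (less i)
  have orth: "gso b l \<bullet> gso b j = 0" if "l < i" "l \<noteq> j" for l
    using that less by (metis inner_commute linorder_neqE_nat)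
  have "gso b i \<bullet> gso b j =
      b i \<bullet> gso b j - (\<Sum>l<i. (b i \<bullet> gso b l / (gso b l \<bullet> gso b l)) * (gso b l \<bullet> gso b j))"
    by (subst gso.simps) (simp add: inner_diff_left inner_sum_left)
  also have "(\<Sum>l<i. (b i \<bullet> gso b l / (gso b l \<bullet> gso b l)) * (gso b l \<bullet> gso b j)) =
      (\<Sum>l\<in>{j}. (b i \<bullet> gso b l / (gso b l \<bullet> gso b l)) * (gso b l \<bullet> gso b j))"
    by (rule sum.mono_neutral_right) (use less.prems orth in auto)
  \<comment> \<open>If \<open>gso b j\<close> is zero, the quotient is 0 by convention, and so is
    the right-hand side.\<close>
  also have "\<dots> = b i \<bullet> gso b j"
    by simp
  finally show ?case by simp
qed

lemma gso_orthogonal: "i \<noteq> j \<Longrightarrow> gso b i \<bullet> gso b j = 0"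
  by (metis gso_orthogonal_less inner_commute linorder_neqE_nat)

lemma gso_decomp_sum:
  assumes "i < k"
  shows "b i = (\<Sum>l<k. (if l < i then gso_coeff b i l else if l = i then 1 else 0) *\<^sub>R gso b l)"
proof -
  have "(\<Sum>l<k. (if l < i then gso_coeff b i l else if l = i then 1 else 0) *\<^sub>R gso b l)
      = (\<Sum>l\<in>insert i {..<i}. (if l < i then gso_coeff b i l else if l = i then 1 else 0) *\<^sub>R gso b l)"
    by (rule sum.mono_neutral_right) (use assms in auto)
  also have "\<dots> = b i"
    using gso_decomp[of b i] by simp
  finally show ?thesis by simp
qed

text \<open>The Gram matrix factors as L D L^T, with L the unit lower triangular matrix of
  Gram-Schmidt coefficients and D diagonal with the squared norms of the Gram-Schmidt
  vectors.\<close>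

lemma gram_det:
  fixes b :: "nat \<Rightarrow> 'a :: real_inner"
  shows "det (mat k k (\<lambda>(i, j). b i \<bullet> b j)) = (\<Prod>i<k. (norm (gso b i))\<^sup>2)"
proof -
  define f where "f = (\<lambda>i l. if l < i then gso_coeff b i l else if l = i then 1 else (0::real))"
  define L where "L = mat k k (\<lambda>(i, l). f i l)"
  define D where "D = mat k k (\<lambda>(i, l). if i = l then (norm (gso b i))\<^sup>2 else 0)"
  have carr: "L \<in> carrier_mat k k" "D \<in> carrier_mat k k"
    by (auto simp: L_def D_def)
  have inner: "b i \<bullet> b j = (\<Sum>l<k. f i l * (norm (gso b l))\<^sup>2 * f j l)" if "i < k" "j < k" for i j
  proof -
    have "b i \<bullet> b j = (\<Sum>l<k. f i l *\<^sub>R gso b l) \<bullet> (\<Sum>l<k. f j l *\<^sub>R gso b l)"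
      using gso_decomp_sum[OF that(1), of b] gso_decomp_sum[OF that(2), of b] by (simp add: f_def)
    also have "\<dots> = (\<Sum>l<k. \<Sum>l'<k. f i l * f j l' * (gso b l \<bullet> gso b l'))"
      unfolding inner_sum_left inner_sum_right by (subst sum.swap) (simp add: mult_ac)
    also have "\<dots> = (\<Sum>l<k. f i l * f j l * (gso b l \<bullet> gso b l))"
    proof (rule sum.cong[OF refl])
      fix l assume "l \<in> {..<k}"
      then have "(\<Sum>l'<k. f i l * f j l' * (gso b l \<bullet> gso b l'))
          = (\<Sum>l'\<in>{l}. f i l * f j l' * (gso b l \<bullet> gso b l'))"
        by (intro sum.mono_neutral_right) (auto simp: gso_orthogonal)
      then show "(\<Sum>l'<k. f i l * f j l' * (gso b l \<bullet> gso b l')) = f i l * f j l * (gso b l \<bullet> gso b l)"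
        by simp
    qed
    finally show ?thesis
      by (simp add: power2_norm_eq_inner mult_ac)
  qed
  have LD: "L * D = mat k k (\<lambda>(i, l). f i l * (norm (gso b l))\<^sup>2)"
  proof (rule eq_matI, goal_cases)
    case (1 i l)
    then have "(L * D) $$ (i, l) = (\<Sum>j\<in>{0..<k}. f i j * (if j = l then (norm (gso b j))\<^sup>2 else 0))"
      by (simp add: L_def D_def scalar_prod_def)
    also have "\<dots> = (\<Sum>j\<in>{l}. f i j * (if j = l then (norm (gso b j))\<^sup>2 else 0))"
      using 1 by (intro sum.mono_neutral_right) auto
    finally show ?case using 1 by simp
  qed (auto simp: L_def D_def)
  have "mat k k (\<lambda>(i, j). b i \<bullet> b j) = (L * D) * transpose_mat L"
    unfolding LD
    by (rule eq_matI) (auto simp: L_def scalar_prod_def inner lessThan_atLeast0)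
  then have "det (mat k k (\<lambda>(i, j). b i \<bullet> b j)) = det L * det D * det L"
    using carr by (simp add: det_mult[of _ k] det_transpose)
  moreover have "det L = 1"
    by (subst det_lower_triangular[of k])
       (auto simp: L_def f_def diag_mat_def prod.list_conv_set_nth)
  moreover have "det D = (\<Prod>i<k. (norm (gso b i))\<^sup>2)"
    by (subst det_lower_triangular[of k])
       (auto simp: D_def diag_mat_def prod.list_conv_set_nth lessThan_atLeast0)
  ultimately show ?thesis by simp
qed

lemma inner_real_vec: "real_vec x \<bullet> real_vec y = real_of_int (\<Sum>l\<in>UNIV. x $ l * y $ l)"
  by (simp add: real_vec_def inner_vec_def)

lemma real_vec_sum: "real_vec (\<Sum>i\<in>A. f i) = (\<Sum>i\<in>A. real_vec (f i))"
  by (simp add: real_vec_def Finite_Cartesian_Product.vec_eq_iff)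

lemma real_vec_add: "real_vec (x + y) = real_vec x + real_vec y"
  by (simp add: real_vec_def Finite_Cartesian_Product.vec_eq_iff)

lemma real_vec_smult: "real_vec (c *s x) = of_int c *\<^sub>R real_vec x"
  by (simp add: real_vec_def Finite_Cartesian_Product.vec_eq_iff)

lemma real_vec_eq_0_iff: "real_vec x = 0 \<longleftrightarrow> x = 0"
  by (simp add: real_vec_def Finite_Cartesian_Product.vec_eq_iff)

text \<open>The product is the Gram determinant, an integer, and nonnegative as a product of
  squares. Were it zero, the Gram matrix would have a nonzero integer kernel vector; the combination
  \<open>s\<close> with these coefficients is orthogonal to every \<open>b i\<close>, hence to
  itself, which contradicts independence.\<close>

lemma prod_gso_ge_1:
  fixes b :: "nat \<Rightarrow> int ^ 'm"
  assumes "int_independent k b"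
  shows "1 \<le> (\<Prod>i<k. (norm (gso (\<lambda>i. real_vec (b i)) i))\<^sup>2)"
proof -
  define G where "G = mat k k (\<lambda>(i, j). \<Sum>l\<in>UNIV. b i $ l * b j $ l)"
  have G: "G \<in> carrier_mat k k" by (simp add: G_def)
  have "map_mat real_of_int G = mat k k (\<lambda>(i, j). real_vec (b i) \<bullet> real_vec (b j))"
    by (rule eq_matI) (auto simp: G_def inner_real_vec)
  then have eq: "(\<Prod>i<k. (norm (gso (\<lambda>i. real_vec (b i)) i))\<^sup>2) = real_of_int (det G)"
    by (simp flip: gram_det of_int_hom.hom_det)
  have "det G \<noteq> 0"
  proof
    assume "det G = 0"
    then obtain x where x: "x \<in> carrier_vec k" "x \<noteq> 0\<^sub>v k" "G *\<^sub>v x = 0\<^sub>v k"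
      using det_0_iff_vec_prod_zero[OF G] by blast
    define c where "c = vec_index x"
    define s where "s = (\<Sum>i<k. c i *s b i)"
    have *: "(\<Sum>l\<in>UNIV. b i $ l * s $ l) = 0" if "i < k" for i
    proof -
      have "0 = vec_index (G *\<^sub>v x) i" using that x by simp
      also have "\<dots> = (\<Sum>j<k. (\<Sum>l\<in>UNIV. b i $ l * b j $ l) * c j)"
        using that x(1) by (simp add: G_def scalar_prod_def c_def lessThan_atLeast0)
      also have "\<dots> = (\<Sum>j<k. \<Sum>l\<in>UNIV. b i $ l * (c j * b j $ l))"
        by (simp add: sum_distrib_left sum_distrib_right mult_ac)
      also have "\<dots> = (\<Sum>l\<in>UNIV. \<Sum>j<k. b i $ l * (c j * b j $ l))"
        by (rule sum.swap)
      also have "\<dots> = (\<Sum>l\<in>UNIV. b i $ l * s $ l)"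
        by (simp add: s_def sum_distrib_left)
      finally show ?thesis by simp
    qed
    have "real_vec s \<bullet> real_vec s = (\<Sum>i<k. of_int (c i) * (real_vec (b i) \<bullet> real_vec s))"
      by (subst (1) s_def) (simp add: real_vec_sum real_vec_smult inner_sum_left)
    also have "\<dots> = 0"
      by (rule sum.neutral) (simp only: inner_real_vec *, simp add: *)
    finally have "s = 0" by (simp add: real_vec_eq_0_iff)
    then have "\<forall>i<k. c i = 0"
      using assms by (simp add: int_independent_def s_def)
    then have "x = 0\<^sub>v k"
      using x(1) by (intro eq_vecI) (auto simp: c_def)
    with x(2) show False by simp
  qed
  moreover have "real_of_int (det G) \<ge> 0"
    unfolding eq[symmetric] by (intro prod_nonneg) auto
  ultimately have "det G \<ge> 1" by linarith
  then show ?thesis by (simp add: eq)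
qed

section \<open>Reduced bases\<close>

text \<open>Combine the Lovasz condition with the bound 1/4 on the square of the coefficient: the
  part of \<open>gso b i\<close> on the right moves to the left and leaves the factor \<delta> -
  1/4.\<close>

lemma lll_gso_step:
  assumes lll: "lll_reduced \<delta> k b" and "Suc i < k" and \<delta>: "1 / 4 < \<delta>"
    and c: "c = inverse (\<delta> - 1 / 4)"
  shows "(norm (gso b i))\<^sup>2 \<le> c * (norm (gso b (Suc i)))\<^sup>2"
proof -
  let ?r = "gso_coeff b (Suc i) i"
  have "\<delta> * (norm (gso b i))\<^sup>2 \<le> (norm (gso b (Suc i) + ?r *\<^sub>R gso b i))\<^sup>2"
    using lll assms(2) by (simp add: lll_reduced_def)
  also have "\<dots> = (norm (gso b (Suc i)))\<^sup>2 + ?r\<^sup>2 * (norm (gso b i))\<^sup>2"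
    by (subst norm_add_Pythagorean)
       (simp_all add: real_inner_class.orthogonal_def gso_orthogonal power_mult_distrib)
  also have "?r\<^sup>2 \<le> 1 / 4"
  proof -
    have "\<bar>?r\<bar> \<le> 1 / 2"
      using lll assms(2) by (simp add: lll_reduced_def)
    then have "\<bar>?r\<bar>\<^sup>2 \<le> (1 / 2)\<^sup>2" by (intro power_mono) auto
    then show ?thesis by (simp add: power2_eq_square)
  qed
  finally have "(\<delta> - 1 / 4) * (norm (gso b i))\<^sup>2 \<le> (norm (gso b (Suc i)))\<^sup>2"
    by (simp add: algebra_simps mult_right_mono)
  then show ?thesis
    using \<delta> unfolding c by (simp add: field_simps)
qed

lemma lll_gso_chain:
  assumes lll: "lll_reduced \<delta> k b" and \<delta>: "1 / 4 < \<delta>"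
    and c: "c = inverse (\<delta> - 1 / 4)"
  shows "j + d < k \<Longrightarrow> (norm (gso b j))\<^sup>2 \<le> c ^ d * (norm (gso b (j + d)))\<^sup>2"
proof (induction d)
  case (Suc d)
  have "c > 0" using \<delta> c by simp
  have "(norm (gso b j))\<^sup>2 \<le> c ^ d * (norm (gso b (j + d)))\<^sup>2"
    using Suc by simp
  also have "\<dots> \<le> c ^ d * (c * (norm (gso b (Suc (j + d))))\<^sup>2)"
    using \<open>c > 0\<close> Suc.prems by (intro mult_left_mono lll_gso_step[OF lll _ \<delta> c]) auto
  finally show ?case by (simp add: mult_ac)
qed simp

lemma norm_sq_gso_decomp:
  "(norm (b j))\<^sup>2 = (norm (gso b j))\<^sup>2 + (\<Sum>l<j. (gso_coeff b j l)\<^sup>2 * (norm (gso b l))\<^sup>2)"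
proof -
  have pw: "pairwise (\<lambda>l l'. real_inner_class.orthogonal (gso_coeff b j l *\<^sub>R gso b l) (gso_coeff b j l' *\<^sub>R gso b l')) {..<j}"
    by (auto simp: pairwise_def real_inner_class.orthogonal_def gso_orthogonal)
  have "(norm (b j))\<^sup>2 = (norm (gso b j + (\<Sum>l<j. gso_coeff b j l *\<^sub>R gso b l)))\<^sup>2"
    by (subst gso_decomp) simp
  also have "\<dots> = (norm (gso b j))\<^sup>2 + (norm (\<Sum>l<j. gso_coeff b j l *\<^sub>R gso b l))\<^sup>2"
    by (rule norm_add_Pythagorean) (auto simp: real_inner_class.orthogonal_def inner_sum_right gso_orthogonal intro!: sum.neutral)
  also have "(norm (\<Sum>l<j. gso_coeff b j l *\<^sub>R gso b l))\<^sup>2 =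
      (\<Sum>l<j. (norm (gso_coeff b j l *\<^sub>R gso b l))\<^sup>2)"
    by (rule norm_sum_Pythagorean) (use pw in auto)
  finally show ?thesis by (simp add: power_mult_distrib)
qed

lemma norm_gso_le: "norm (gso b j) \<le> norm (b j)"
proof (rule power2_le_imp_le)
  show "(norm (gso b j))\<^sup>2 \<le> (norm (b j))\<^sup>2"
    by (subst norm_sq_gso_decomp) (auto intro: sum_nonneg)
qed auto

text \<open>Size reduction and the chain of Gram-Schmidt norms bound the squared norm of
  \<open>b j\<close> by a geometric sum times that of \<open>gso b j\<close>; the sum is at most
  \<open>c ^ j\<close>, and the chain from \<open>j\<close> to \<open>i\<close> supplies the
  remaining factor \<open>c ^ (i - j)\<close>.\<close>

lemma lll_norm_le:
  assumes lll: "lll_reduced \<delta> k b" and \<delta>: "1 / 4 < \<delta>" "\<delta> < 1"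
    and c: "c = inverse (\<delta> - 1 / 4)" and "j \<le> i" "i < k"
  shows "(norm (b j))\<^sup>2 \<le> c ^ i * (norm (gso b i))\<^sup>2"
proof -
  have c43: "c \<ge> 4 / 3"
    using \<delta> unfolding c by (simp add: field_simps)
  \<comment> \<open>The induction step amounts to 4/3 c^j \<le> c^(j+1), which is where \<delta> < 1
    enters through \<open>c43\<close>.\<close>
  have geo: "1 + (\<Sum>l<j. c ^ (j - l)) / 4 \<le> c ^ j" for j
  proof (induction j)
    case (Suc j)
    have "(\<Sum>l<Suc j. c ^ (Suc j - l)) = c ^ Suc j + (\<Sum>l<j. c ^ (j - l))"
      by (subst sum.lessThan_Suc_shift) simp
    moreover have "4 / 3 * c ^ j \<le> c * c ^ j"
      using c43 by (intro mult_right_mono) auto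
    ultimately show ?case using Suc by (simp add: field_simps)
  qed simp
  have "(norm (b j))\<^sup>2 \<le> (norm (gso b j))\<^sup>2 + (\<Sum>l<j. (1 / 4) * (c ^ (j - l) * (norm (gso b j))\<^sup>2))"
    unfolding norm_sq_gso_decomp[of b j]
  proof (intro add_left_mono sum_mono mult_mono)
    fix l assume l: "l \<in> {..<j}"
    then have "\<bar>gso_coeff b j l\<bar> \<le> 1 / 2"
      using lll assms by (simp add: lll_reduced_def)
    then have "\<bar>gso_coeff b j l\<bar>\<^sup>2 \<le> (1 / 2)\<^sup>2" by (intro power_mono) auto
    then show "(gso_coeff b j l)\<^sup>2 \<le> 1 / 4" by (simp add: power2_eq_square)
    show "(norm (gso b l))\<^sup>2 \<le> c ^ (j - l) * (norm (gso b j))\<^sup>2"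
      using lll_gso_chain[OF lll \<delta>(1) c, of l "j - l"] l assms by simp
  qed auto
  also have "\<dots> = (1 + (\<Sum>l<j. c ^ (j - l)) / 4) * (norm (gso b j))\<^sup>2"
    by (simp add: algebra_simps sum_distrib_left sum_distrib_right sum_divide_distrib)
  also have "\<dots> \<le> c ^ j * (norm (gso b j))\<^sup>2"
    by (intro mult_right_mono geo) auto
  also have "\<dots> \<le> c ^ j * (c ^ (i - j) * (norm (gso b (j + (i - j))))\<^sup>2)"
    using c43 assms by (intro mult_left_mono lll_gso_chain[OF lll \<delta>(1) c]) auto
  also have "\<dots> = c ^ i * (norm (gso b i))\<^sup>2"
    using assms by (simp flip: power_add mult.assoc)
  finally show ?thesis .
qed

lemma inner_gso_self: "b i \<bullet> gso b i = (norm (gso b i))\<^sup>2"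
  by (subst (1) gso_decomp)
     (simp add: inner_add_left inner_sum_left gso_orthogonal power2_norm_eq_inner)

lemma inner_gso_later: "l < i \<Longrightarrow> b l \<bullet> gso b i = 0"
  by (subst (1) gso_decomp)
     (simp add: inner_add_left inner_sum_left gso_orthogonal)

text \<open>Pairing the combination with \<open>gso b i\<close> kills all earlier vectors and leaves
  \<open>r i\<close> times the squared norm of \<open>gso b i\<close>; Cauchy-Schwarz does the
  rest.\<close>

lemma coeff_mult_norm_gso_le:
  fixes r :: "nat \<Rightarrow> int"
  assumes "i < k" "\<And>l. l < k \<Longrightarrow> i < l \<Longrightarrow> r l = 0"
  shows "\<bar>of_int (r i)\<bar> * norm (gso b i) \<le> norm (\<Sum>l<k. of_int (r l) *\<^sub>R b l)"
proof (cases "gso b i = 0")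
  case False
  let ?y = "\<Sum>l<k. of_int (r l) *\<^sub>R b l"
  have "?y \<bullet> gso b i = (\<Sum>l<k. of_int (r l) * (b l \<bullet> gso b i))"
    by (simp add: inner_sum_left)
  also have "\<dots> = (\<Sum>l\<in>{i}. of_int (r l) * (b l \<bullet> gso b i))"
  proof (rule sum.mono_neutral_right)
    show "\<forall>l\<in>{..<k} - {i}. of_int (r l) * (b l \<bullet> gso b i) = 0"
      using assms by (metis DiffE insertCI inner_gso_later lessThan_iff linorder_neqE_nat mult_eq_0_iff of_int_0)
  qed (use assms in auto)
  finally have "\<bar>?y \<bullet> gso b i\<bar> = \<bar>of_int (r i)\<bar> * (norm (gso b i))\<^sup>2"
    by (simp add: inner_gso_self abs_mult)
  then have "(\<bar>of_int (r i)\<bar> * norm (gso b i)) * norm (gso b i) \<le> norm ?y * norm (gso b i)"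
    using Cauchy_Schwarz_ineq2[of ?y "gso b i"] by (simp add: power2_eq_square mult_ac)
  then show ?thesis
    using False by simp
qed simp

text \<open>Let \<open>t\<close> be the last index with a nonzero coefficient. The combination is at
  least as long as \<open>gso b t\<close>, and j \<le> i \<le> t. Thus a single lattice vector with
  a nonzero coordinate at \<open>i\<close> controls all basis vectors up to index
  \<open>i\<close>.\<close>

lemma lll_norm_le_norm_combination:
  fixes r :: "nat \<Rightarrow> int"
  assumes lll: "lll_reduced \<delta> k b" and \<delta>: "1 / 4 < \<delta>" "\<delta> < 1"
    and c: "c = inverse (\<delta> - 1 / 4)" and "i < k" "r i \<noteq> 0" "j \<le> i"
  shows "(norm (b j))\<^sup>2 \<le> c ^ (k - 1) * (norm (\<Sum>l<k. of_int (r l) *\<^sub>R b l))\<^sup>2"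
proof -
  define t where "t = Max {l. l < k \<and> r l \<noteq> 0}"
  have fin: "finite {l. l < k \<and> r l \<noteq> 0}" by simp
  have "t \<in> {l. l < k \<and> r l \<noteq> 0}"
    unfolding t_def using assms by (intro Max_in) auto
  then have t: "t < k" "r t \<noteq> 0" by auto
  have max: "l \<le> t" if "l < k" "r l \<noteq> 0" for l
    unfolding t_def using that fin by (intro Max_ge) auto
  have c1: "c \<ge> 1"
    using \<delta> unfolding c by (simp add: field_simps)
  have "(norm (b j))\<^sup>2 \<le> c ^ t * (norm (gso b t))\<^sup>2"
    using assms max[of i] t by (intro lll_norm_le[OF lll \<delta> c]) auto
  also have "\<dots> \<le> c ^ (k - 1) * (norm (\<Sum>l<k. of_int (r l) *\<^sub>R b l))\<^sup>2"
  proof (intro mult_mono power_mono power_increasing)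
    show "norm (gso b t) \<le> norm (\<Sum>l<k. of_int (r l) *\<^sub>R b l)"
    proof -
      have "1 \<le> \<bar>real_of_int (r t)\<bar>" using t(2) by linarith
      then have "1 * norm (gso b t) \<le> \<bar>real_of_int (r t)\<bar> * norm (gso b t)"
        by (intro mult_right_mono) auto
      also have "\<dots> \<le> norm (\<Sum>l<k. of_int (r l) *\<^sub>R b l)"
        using t max by (intro coeff_mult_norm_gso_le) force+
      finally show ?thesis by simp
    qed
  qed (use t c1 in auto)
  finally show ?thesis .
qed

section \<open>Rational spans\<close>

text \<open>Infinite descent: in an integer relation \<open>N\<close> divides every coefficient, and
  dividing by \<open>N\<close> gives a relation again, so every power of \<open>N\<close> divides
  every coefficient.\<close>

lemma lin_indep_mod_imp_int_independent:
  assumes "N > 1" "lin_indep_mod N n v"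
  shows "int_independent n v"
  unfolding int_independent_def
proof (intro allI impI)
  fix x :: "nat \<Rightarrow> int" and i assume x: "(\<Sum>i<n. x i *s v i) = 0" and i: "i < n"
  have "\<forall>i<n. N ^ k dvd x i" if "(\<Sum>i<n. x i *s v i) = 0" for k and x :: "nat \<Rightarrow> int"
    using that
  proof (induction k arbitrary: x)
    case (Suc k)
    have eq0: "(\<Sum>i<n. x i * v i $ j) = 0" for j
      using arg_cong[OF Suc.prems, of "\<lambda>w. w $ j"] by simp
    then have dvd: "N dvd x i" if "i < n" for i
      using assms(2) that unfolding lin_indep_mod_def by (metis cong_0_iff dvd_0_right)
    define y where "y = (\<lambda>i. x i div N)"
    have xy: "x i = N * y i" if "i < n" for i
      using dvd[OF that] by (simp add: y_def)
    have "(\<Sum>i<n. y i *s v i) = 0"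
    proof (subst Finite_Cartesian_Product.vec_eq_iff, rule allI)
      fix j
      have "N * (\<Sum>i<n. y i * v i $ j) = (\<Sum>i<n. x i * v i $ j)"
        by (simp add: sum_distrib_left xy mult_ac)
      then show "(\<Sum>i<n. y i *s v i) $ j = 0 $ j"
        using assms(1) eq0 by simp
    qed
    then show ?case
      using Suc.IH xy by fastforce
  qed simp
  \<comment> \<open>This exponent is large enough for the power to exceed \<bar>x i\<bar>, so
    divisibility leaves only 0.\<close>
  from this[OF x] i have "N ^ nat (\<bar>x i\<bar>) dvd x i" by blast
  moreover have "\<bar>x i\<bar> < N ^ nat \<bar>x i\<bar>"
  proof -
    have "int (nat \<bar>x i\<bar>) < int (2 ^ nat \<bar>x i\<bar>)"
      by (subst of_nat_less_iff) (rule less_exp)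
    also have "\<dots> \<le> N ^ nat \<bar>x i\<bar>"
      using assms(1) by (simp add: power_mono)
    finally show ?thesis by simp
  qed
  ultimately show "x i = 0"
    using dvd_imp_le_int[of "x i" "N ^ nat \<bar>x i\<bar>"] by (cases "x i = 0") auto
qed

section \<open>Passage from integer relations to rational linear algebra\<close>

lemma rat_vec_sum: "rat_vec (\<Sum>i\<in>A. f i) = (\<Sum>i\<in>A. rat_vec (f i))"
  by (simp add: rat_vec_def Finite_Cartesian_Product.vec_eq_iff)

lemma rat_vec_add: "rat_vec (x + y) = rat_vec x + rat_vec y"
  by (simp add: rat_vec_def Finite_Cartesian_Product.vec_eq_iff)

lemma rat_vec_smult: "rat_vec (c *s x) = of_int c *s rat_vec x"
  by (simp add: rat_vec_def Finite_Cartesian_Product.vec_eq_iff)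

lemma rat_vec_eq_iff: "rat_vec x = rat_vec y \<longleftrightarrow> x = y"
  by (simp add: rat_vec_def Finite_Cartesian_Product.vec_eq_iff)

lemma rat_vec_0 [simp]: "rat_vec 0 = 0"
  by (simp add: rat_vec_def Finite_Cartesian_Product.vec_eq_iff)

lemma rat_common_denominator:
  fixes q :: "nat \<Rightarrow> rat"
  obtains d :: int and x :: "nat \<Rightarrow> int" where "d > 0" "\<And>i. i < n \<Longrightarrow> of_int d * q i = of_int (x i)"
proof -
  have "\<exists>d>0. \<forall>i<n. of_int d * q i \<in> \<int>"
  proof (induction n)
    case (Suc n)
    then obtain d where d: "d > 0" "\<forall>i<n. of_int d * q i \<in> \<int>" by blast
    obtain a b where ab: "quotient_of (q n) = (a, b)" by fastforce
    then have b: "b > 0" "q n = of_int a / of_int b"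
      by (auto simp: quotient_of_denom_pos quotient_of_div)
    have "of_int (d * b) * q i \<in> \<int>" if i: "i < Suc n" for i
    proof (cases "i = n")
      case True
      have "of_int (d * b) * q i = of_int (d * a)" using b True by simp
      then show ?thesis by (metis Ints_of_int)
    next
      case False
      then have "of_int d * q i \<in> \<int>"
        using d i by auto
      then have "of_int b * (of_int d * q i) \<in> \<int>"
        by (rule Ints_mult[OF Ints_of_int])
      then show ?thesis by (simp add: mult_ac)
    qed
    with b d show ?case by (metis mult_pos_pos)
  qed (auto intro: exI[of _ 1])
  then obtain d where d: "d > 0" "\<forall>i<n. of_int d * q i \<in> \<int>" by blast
  then have "\<forall>i. \<exists>x. i < n \<longrightarrow> of_int d * q i = of_int x" by (auto elim: Ints_cases)
  then obtain x where "\<forall>i. i < n \<longrightarrow> of_int d * q i = of_int (x i)" by metis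
  with d that show thesis by blast
qed

lemma int_independent_imp_inj:
  assumes "int_independent n v"
  shows "inj_on (\<lambda>i. rat_vec (v i)) {..<n}"
proof (rule inj_onI, rule ccontr)
  fix i j assume ij: "i \<in> {..<n}" "j \<in> {..<n}" "rat_vec (v i) = rat_vec (v j)" "i \<noteq> j"
  then have eq: "v i = v j" by (simp add: rat_vec_eq_iff)
  define x where "x = (\<lambda>l. if l = i then 1 else if l = j then -1 else (0::int))"
  have "(\<Sum>l<n. x l *s v l) = (\<Sum>l\<in>{i, j}. x l *s v l)"
    by (rule sum.mono_neutral_right) (use ij in \<open>auto simp: x_def\<close>)
  also have "\<dots> = 0"
    using ij eq by (simp add: x_def Finite_Cartesian_Product.vec_eq_iff)
  finally have "x i = 0" using assms ij by (auto simp: int_independent_def)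
  then show False by (simp add: x_def)
qed

lemma int_independent_imp_independent:
  assumes "int_independent n v"
  shows "vec.independent ((\<lambda>i. rat_vec (v i)) ` {..<n})"
proof
  assume "vec.dependent ((\<lambda>i. rat_vec (v i)) ` {..<n})"
  then obtain f j where j: "j < n" "f (rat_vec (v j)) \<noteq> 0"
    and rel: "(\<Sum>w\<in>(\<lambda>i. rat_vec (v i)) ` {..<n}. f w *s w) = 0"
    by (auto simp: vec.dependent_finite)
  define q where "q = (\<lambda>i. f (rat_vec (v i)))"
  have rel: "(\<Sum>i<n. q i *s rat_vec (v i)) = 0"
    using rel by (subst (asm) sum.reindex[OF int_independent_imp_inj[OF assms]]) (simp add: q_def)
  obtain d and x :: "nat \<Rightarrow> int" where d: "d > 0" "\<And>i. i < n \<Longrightarrow> of_int d * q i = of_int (x i)"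
    using rat_common_denominator[where q = q and n = n] by metis
  have "rat_vec (\<Sum>i<n. x i *s v i) = (\<Sum>i<n. of_int d *s (q i *s rat_vec (v i)))"
    by (simp add: rat_vec_sum rat_vec_smult vec.scale_scale d(2))
  also have "\<dots> = 0"
    using rel by (subst vec.scale_sum_right[symmetric]) simp
  finally have "(\<Sum>i<n. x i *s v i) = 0"
    by (metis rat_vec_eq_iff rat_vec_0)
  then have "x j = 0" using assms j by (simp add: int_independent_def)
  then have "of_int d * q j = 0" using d(2)[OF j(1)] by simp
  with d(1) j(2) show False by (simp add: q_def)
qed

lemma lattice_gen_memberI: "(\<Sum>i<k. x i *s u i) \<in> lattice_gen k u"
  by (auto simp: lattice_gen_def)

lemma lattice_gen_generator:
  assumes "j < k"
  shows "u j \<in> lattice_gen k u"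
proof -
  have "u j = (\<Sum>i<k. (if i = j then 1 else 0) *s u i)"
    using assms by (simp add: if_distrib[of "\<lambda>c. c *s _"] cong: if_cong)
  then show ?thesis using lattice_gen_memberI[of "\<lambda>i. if i = j then 1 else 0" u k] by simp
qed

lemma span_lattice_gen:
  "vec.span (rat_vec ` lattice_gen n v) = vec.span ((\<lambda>i. rat_vec (v i)) ` {..<n})"
proof (rule vec.span_eq[THEN iffD2], safe)
  fix w assume "w \<in> lattice_gen n v"
  then obtain x where "w = (\<Sum>i<n. x i *s v i)" by (auto simp: lattice_gen_def)
  then show "rat_vec w \<in> vec.span ((\<lambda>i. rat_vec (v i)) ` {..<n})"
    by (simp add: rat_vec_sum rat_vec_smult) (intro vec.span_sum vec.span_scale, auto intro: vec.span_base)
next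
  fix i assume "i < n"
  then have "v i \<in> lattice_gen n v" by (rule lattice_gen_generator)
  then show "rat_vec (v i) \<in> vec.span (rat_vec ` lattice_gen n v)"
    by (auto intro: vec.span_base)
qed

lemma int_independent_extend:
  assumes ind: "int_independent n v"
    and u: "rat_vec u \<notin> vec.span ((\<lambda>i. rat_vec (v i)) ` {..<n})"
  shows "int_independent (Suc n) (v(n := u))"
  unfolding int_independent_def
proof (intro allI impI)
  fix x :: "nat \<Rightarrow> int" and i
  assume x: "(\<Sum>i<Suc n. x i *s (v(n := u)) i) = 0" and i: "i < Suc n"
  then have eq: "(\<Sum>i<n. x i *s v i) + x n *s u = 0" by simp
  have xn: "x n = 0"
  proof (rule ccontr)
    assume "x n \<noteq> 0"
    have "(\<Sum>i<n. of_int (x i) *s rat_vec (v i)) + of_int (x n) *s rat_vec u = 0"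
      using arg_cong[OF eq, of rat_vec] by (simp add: rat_vec_add rat_vec_sum rat_vec_smult)
    then have "of_int (x n) *s rat_vec u = - (\<Sum>i<n. of_int (x i) *s rat_vec (v i))"
      by (simp add: add_eq_0_iff)
    then have "rat_vec u = (1 / of_int (x n)) *s - (\<Sum>i<n. of_int (x i) *s rat_vec (v i))"
      using \<open>x n \<noteq> 0\<close> by (metis (no_types, lifting) nonzero_divide_eq_eq of_int_eq_0_iff vec.scale_one vec.scale_scale)
    also have "\<dots> \<in> vec.span ((\<lambda>i. rat_vec (v i)) ` {..<n})"
      by (intro vec.span_scale vec.span_neg vec.span_sum) (auto intro: vec.span_base)
    finally show False using u by simp
  qed
  with eq ind have "\<forall>i<n. x i = 0"
    by (simp add: int_independent_def)
  with xn i show "x i = 0" by (cases "i = n") auto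
qed

text \<open>The square of \<open>family_size\<close> is the arithmetic mean of the squared norms, so
  this is the inequality of arithmetic and geometric means.\<close>

lemma prod_norm_sq_le_family_size:
  assumes "n > 0"
  shows "(\<Prod>i<n. (norm (real_vec (v i)))\<^sup>2) \<le> (family_size n v)\<^sup>2 ^ n"
proof -
  let ?p = "\<Prod>i<n. (norm (real_vec (v i)))\<^sup>2"
  have "?p powr (1 / n) \<le> (\<Sum>i<n. (norm (real_vec (v i)))\<^sup>2) / n"
    using arith_geom_mean[of "{..<n}" "\<lambda>i. (norm (real_vec (v i)))\<^sup>2"] assms
    by (auto simp: sum_divide_distrib)
  also have "\<dots> = (family_size n v)\<^sup>2"
    by (simp add: family_size_def sum_nonneg)
  finally have "(?p powr (1 / n)) ^ n \<le> (family_size n v)\<^sup>2 ^ n"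
    by (intro power_mono) auto
  moreover have "(p powr (1 / n)) ^ n = p" if "p \<ge> 0" for p :: real
    using that assms by (cases "p = 0") (simp_all add: powr_powr flip: powr_realpow)
  ultimately show ?thesis by (simp add: prod_nonneg)
qed

text \<open>
  Writing \<open>u\<close> as a combination of the \<open>v i\<close> plus \<open>N\<close> times an integer vector \<open>u'\<close>, the last
  Gram--Schmidt vector of \<open>v, u'\<close> is shorter than \<open>u\<close> by a factor \<open>N\<close>; if \<open>u\<close> is outside the span,
  this contradicts the fact that the Gram determinant of \<open>v, u'\<close> is a positive integer.
\<close>
lemma short_vector_in_span:
  assumes ind: "int_independent n v" and "n > 0" and "N > 0"
    and size: "family_size n v \<le> \<mu>"
    and cong: "\<And>j. [u $ j = (\<Sum>i<n. c i * v i $ j)] (mod N)"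
    and short: "norm (real_vec u) * \<mu> ^ n < of_int N"
  shows "rat_vec u \<in> vec.span ((\<lambda>i. rat_vec (v i)) ` {..<n})" (is "_ \<in> ?S")
proof (rule ccontr)
  assume notin: "rat_vec u \<notin> ?S"
  define w where "w = (\<chi> j. (u $ j - (\<Sum>i<n. c i * v i $ j)) div N)"
  have uw: "u = (\<Sum>i<n. c i *s v i) + N *s w"
    using cong by (simp add: w_def Finite_Cartesian_Product.vec_eq_iff cong_iff_dvd_diff)
  have "rat_vec w \<notin> ?S"
  proof
    assume "rat_vec w \<in> ?S"
    then have "rat_vec u \<in> ?S"
      unfolding uw rat_vec_add rat_vec_sum rat_vec_smult
      by (intro vec.span_add vec.span_sum vec.span_scale) (auto intro: vec.span_base)
    with notin show False by simp
  qed
  define b where "b = v(n := w)"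
  define g where "g = gso (\<lambda>i. real_vec (b i))"
  have "1 \<le> (\<Prod>i<Suc n. (norm (g i))\<^sup>2)"
    unfolding g_def b_def
    by (intro prod_gso_ge_1 int_independent_extend ind) fact
  also have "\<dots> = (\<Prod>i<n. (norm (g i))\<^sup>2) * (norm (g n))\<^sup>2"
    by simp
  also have "\<dots> \<le> (\<Prod>i<n. (norm (real_vec (v i)))\<^sup>2) * (norm (g n))\<^sup>2"
  proof (intro mult_right_mono prod_mono conjI power_mono)
    fix i assume "i \<in> {..<n}"
    then show "norm (g i) \<le> norm (real_vec (v i))"
      using norm_gso_le[of "\<lambda>i. real_vec (b i)" i] by (simp add: g_def b_def)
  qed auto
  also have "\<dots> \<le> (\<mu>\<^sup>2) ^ n * (norm (g n))\<^sup>2"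
  proof -
    have "(family_size n v)\<^sup>2 \<le> \<mu>\<^sup>2"
      using size by (rule power_mono) (simp add: family_size_def sum_nonneg)
    then have "(family_size n v)\<^sup>2 ^ n \<le> (\<mu>\<^sup>2) ^ n" by (rule power_mono) simp
    from order.trans[OF prod_norm_sq_le_family_size[OF \<open>n > 0\<close>, of v] this] show ?thesis
      by (rule mult_right_mono) simp
  qed
  finally have ge1: "1 \<le> (\<mu>\<^sup>2) ^ n * (norm (g n))\<^sup>2" .
  \<comment> \<open>In terms of \<open>b\<close>, the vector \<open>u\<close> has last coefficient
    \<open>N\<close>, so its component along \<open>g n\<close> is \<open>N\<close> times
    \<open>g n\<close>.\<close>
  have "\<bar>of_int ((c(n := N)) n)\<bar> * norm (g n)
      \<le> norm (\<Sum>l<Suc n. of_int ((c(n := N)) l) *\<^sub>R real_vec (b l))"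
    unfolding g_def by (rule coeff_mult_norm_gso_le) auto
  also have "(\<Sum>l<Suc n. of_int ((c(n := N)) l) *\<^sub>R real_vec (b l)) = real_vec ((\<Sum>i<n. c i *s v i) + N *s w)"
    by (simp add: real_vec_sum real_vec_smult real_vec_add b_def)
  also have "\<dots> = real_vec u" by (simp add: uw)
  finally have "of_int N * norm (g n) \<le> norm (real_vec u)"
    using \<open>N > 0\<close> by simp
  then have "(of_int N * norm (g n))\<^sup>2 \<le> (norm (real_vec u))\<^sup>2"
    using \<open>N > 0\<close> by (intro power_mono) auto
  then have "(\<mu>\<^sup>2) ^ n * (of_int N * norm (g n))\<^sup>2 \<le> (\<mu>\<^sup>2) ^ n * (norm (real_vec u))\<^sup>2"
    by (intro mult_left_mono) auto
  moreover have "(of_int N)\<^sup>2 * 1 \<le> (real_of_int N)\<^sup>2 * ((\<mu>\<^sup>2) ^ n * (norm (g n))\<^sup>2)"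
    using ge1 by (intro mult_left_mono) auto
  ultimately have "(real_of_int N)\<^sup>2 \<le> (norm (real_vec u) * \<mu> ^ n)\<^sup>2"
    by (simp add: power_mult_distrib mult_ac flip: power_mult power_even_eq)
  moreover have "0 \<le> \<mu>"
    using size by (rule order.trans[rotated]) (simp add: family_size_def sum_nonneg)
  ultimately show False
    using short \<open>N > 0\<close> by (simp add: abs_le_square_iff[symmetric])
qed

section \<open>Comparison of a basis of the congruence lattice with the hidden lattice\<close>

lemma int_independent_permute:
  assumes ind: "int_independent m u" and p: "p permutes {..<m}" and "n \<le> m"
  shows "int_independent n (u \<circ> p)"
  unfolding int_independent_def
proof (intro allI impI)
  fix x :: "nat \<Rightarrow> int" and i
  assume x: "(\<Sum>i<n. x i *s (u \<circ> p) i) = 0" and i: "i < n"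
  define y where "y = (\<lambda>i. if i < n then x i else 0)"
  have "(\<Sum>j<m. y (inv_into UNIV p j) *s u j) = (\<Sum>i<m. y (inv_into UNIV p (p i)) *s u (p i))"
    by (rule sum.permute[OF p, unfolded comp_def])
  also have "\<dots> = (\<Sum>i<m. y i *s u (p i))"
    using permutes_inverses(2)[OF p] by simp
  also have "\<dots> = (\<Sum>i<n. y i *s u (p i))"
    using \<open>n \<le> m\<close> by (intro sum.mono_neutral_right) (auto simp: y_def)
  also have "\<dots> = 0"
    using x by (simp add: y_def)
  finally have "(\<Sum>j<m. y (inv_into UNIV p j) *s u j) = 0" .
  then have "\<forall>j<m. y (inv_into UNIV p j) = 0"
    using ind[unfolded int_independent_def, THEN spec, of "\<lambda>j. y (inv_into UNIV p j)"] by blast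
  moreover have "p i < m"
    using permutes_in_image[OF p, of i] i \<open>n \<le> m\<close> by simp
  ultimately have "y (inv_into UNIV p (p i)) = 0" by blast
  then show "x i = 0"
    using i permutes_inverses(2)[OF p] by (simp add: y_def)
qed

text \<open>By dimension, \<open>n\<close> independent vectors in an \<open>n\<close>-dimensional
  space span it, and the completion depends only on the rational span.\<close>

lemma span_eq_of_independent_subset:
  assumes v: "int_independent n v" and u: "int_independent n u"
    and sub: "\<And>i. i < n \<Longrightarrow> rat_vec (u i) \<in> vec.span ((\<lambda>i. rat_vec (v i)) ` {..<n})"
  shows "lattice_completion (lattice_gen n u) = lattice_completion (lattice_gen n v)"
proof -
  let ?V = "(\<lambda>i. rat_vec (v i)) ` {..<n}" and ?U = "(\<lambda>i. rat_vec (u i)) ` {..<n}"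
  have card: "card ?V = n" "card ?U = n"
    using int_independent_imp_inj[OF v] int_independent_imp_inj[OF u] by (auto simp: card_image)
  have "vec.dim (vec.span ?V) = n"
    using vec.dim_span_eq_card_independent[OF int_independent_imp_independent[OF v]] card by simp
  moreover have US: "?U \<subseteq> vec.span ?V" using sub by auto
  ultimately have "vec.span ?V \<subseteq> vec.span ?U"
    using vec.card_ge_dim_independent[OF _ int_independent_imp_independent[OF u]] card by simp
  moreover have "vec.span ?U \<subseteq> vec.span ?V"
    using US by (intro vec.span_minimal) auto
  ultimately have "vec.span ?U = vec.span ?V" by blast
  then show ?thesis by (simp add: lattice_completion_def span_lattice_gen)
qed

text \<open>Otherwise \<open>n\<close> independent vectors would lie in the span of
  \<open>n - 1\<close> vectors. The multiples \<open>N *s v i\<close> are used because they always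
  lie in the congruence lattice, whereas the \<open>v i\<close> need not. The column of
  \<open>B\<close> found here is nonzero and later serves as the normal vector of the hyperplane to
  be avoided.\<close>

lemma exists_nonzero_coordinate_ge:
  fixes B :: "nat \<Rightarrow> nat \<Rightarrow> int"
  assumes v: "int_independent n v" and "N \<noteq> 0" and "n > 0"
    and B: "\<And>i. i < n \<Longrightarrow> N *s v i = (\<Sum>j<m. B i j *s u j)"
  shows "\<exists>i<n. \<exists>j<m. n - 1 \<le> j \<and> B i j \<noteq> 0"
proof (rule ccontr)
  assume "\<not> ?thesis"
  then have zero: "B i j = 0" if "i < n" "j < m" "n - 1 \<le> j" for i j
    using that by blast
  let ?V = "(\<lambda>i. rat_vec (v i)) ` {..<n}" and ?U = "(\<lambda>j. rat_vec (u j)) ` {..<n-1}"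
  have "?V \<subseteq> vec.span ?U"
  proof (rule image_subsetI)
    fix i assume "i \<in> {..<n}"
    then have i: "i < n" by simp
    have "of_int N *s rat_vec (v i) = (\<Sum>j<m. of_int (B i j) *s rat_vec (u j))"
      using arg_cong[OF B[OF i], of rat_vec] by (simp add: rat_vec_sum rat_vec_smult)
    moreover have "of_int (B i j) *s rat_vec (u j) \<in> vec.span ?U" if "j < m" for j
    proof (cases "j < n - 1")
      case True
      then show ?thesis by (intro vec.span_scale vec.span_base) auto
    next
      case False
      then show ?thesis using zero[OF i that] by (simp add: vec.span_zero)
    qed
    ultimately have "of_int N *s rat_vec (v i) \<in> vec.span ?U"
      by (auto intro: vec.span_sum)
    then have "inverse (of_int N) *s (of_int N *s rat_vec (v i)) \<in> vec.span ?U"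
      by (rule vec.span_scale)
    then show "rat_vec (v i) \<in> vec.span ?U"
      using \<open>N \<noteq> 0\<close> by (simp add: vec.scale_scale)
  qed
  from vec.independent_span_bound[OF _ int_independent_imp_independent[OF v] this]
  have "card ?V \<le> card ?U" by simp
  also have "card ?U \<le> n - 1" using card_image_le[of "{..<n-1}" "\<lambda>j. rat_vec (u j)"] by simp
  finally show False
    using int_independent_imp_inj[OF v] \<open>n > 0\<close> by (simp add: card_image)
qed

lemma norm_combination_sq_le:
  fixes x :: "nat \<Rightarrow> int"
  assumes "n > 0" "family_size n v \<le> \<mu>"
  shows "(norm (real_vec (\<Sum>i<n. x i *s v i)))\<^sup>2 \<le> of_int (\<Sum>i<n. (x i)\<^sup>2) * (real n * \<mu>\<^sup>2)"
proof -
  have "norm (real_vec (\<Sum>i<n. x i *s v i)) \<le> (\<Sum>i<n. norm (of_int (x i) *\<^sub>R real_vec (v i)))"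
    unfolding real_vec_sum real_vec_smult by (rule norm_sum)
  also have "\<dots> = (\<Sum>i<n. \<bar>of_int (x i)\<bar> * norm (real_vec (v i)))" by simp
  finally have "(norm (real_vec (\<Sum>i<n. x i *s v i)))\<^sup>2 \<le> (\<Sum>i<n. \<bar>of_int (x i)\<bar> * norm (real_vec (v i)))\<^sup>2"
    by (intro power_mono) auto
  also have "\<dots> \<le> (\<Sum>i<n. \<bar>real_of_int (x i)\<bar>\<^sup>2) * (\<Sum>i<n. (norm (real_vec (v i)))\<^sup>2)"
    by (rule Cauchy_Schwarz_ineq_sum)
  also have "\<dots> \<le> of_int (\<Sum>i<n. (x i)\<^sup>2) * (real n * \<mu>\<^sup>2)"
  proof -
    have "(family_size n v)\<^sup>2 \<le> \<mu>\<^sup>2"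
      using assms(2) by (rule power_mono) (simp add: family_size_def sum_nonneg)
    then have "(\<Sum>i<n. (norm (real_vec (v i)))\<^sup>2) \<le> real n * \<mu>\<^sup>2"
      using assms(1) by (simp add: family_size_def sum_nonneg field_simps)
    then show ?thesis by (simp add: mult_left_mono sum_nonneg)
  qed
  finally show ?thesis .
qed

lemma congruence_lattice_combination:
  assumes "\<And>i. i < n \<Longrightarrow> [x i = k * a i] (mod N)"
  shows "(\<Sum>i<n. x i *s v i) \<in> congruence_lattice N (hidden_vec N n v a)"
  unfolding congruence_lattice_def mem_Collect_eq
proof (intro exI allI)
  fix j
  have "[(\<Sum>i<n. x i * v i $ j) = (\<Sum>i<n. k * a i * v i $ j)] (mod N)"
    using assms by (intro cong_sum cong_mult) auto
  also have "(\<Sum>i<n. k * a i * v i $ j) = k * (\<Sum>i<n. a i * v i $ j)"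
    by (simp add: sum_distrib_left mult.assoc)
  also have "[k * (\<Sum>i<n. a i * v i $ j) = k * hidden_vec N n v a $ j] (mod N)"
    by (intro cong_mult) (auto simp: hidden_vec_def cong_def)
  finally show "[(\<Sum>i<n. x i *s v i) $ j = k * hidden_vec N n v a $ j] (mod N)"
    by simp
qed

text \<open>Supplies the congruence hypothesis of \<open>short_vector_in_span\<close> for vectors of
  the lattice.\<close>

lemma congruence_lattice_cong:
  assumes "u \<in> congruence_lattice N (hidden_vec N n v a)"
  shows "\<exists>k. \<forall>j. [u $ j = (\<Sum>i<n. (k * a i) * v i $ j)] (mod N)"
proof -
  from assms obtain k where k: "\<And>j. [u $ j = k * hidden_vec N n v a $ j] (mod N)"
    by (auto simp: congruence_lattice_def)
  have "[u $ j = (\<Sum>i<n. (k * a i) * v i $ j)] (mod N)" for j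
  proof -
    have "[k * hidden_vec N n v a $ j = k * (\<Sum>i<n. a i * v i $ j)] (mod N)"
      by (intro cong_mult) (auto simp: hidden_vec_def cong_def)
    with k[of j] show ?thesis
      by (metis (no_types, lifting) cong_trans mult.assoc sum.cong sum_distrib_left)
  qed
  then show ?thesis by blast
qed

section \<open>Transference by Fourier analysis\<close>

definition unit_char :: "int \<Rightarrow> int \<Rightarrow> complex" where
  "unit_char M t = cis (2 * pi * real_of_int t / real_of_int M)"

lemma unit_char_0 [simp]: "unit_char M 0 = 1"
  by (simp add: unit_char_def)

lemma unit_char_add: "unit_char M (s + t) = unit_char M s * unit_char M t"
  by (simp add: unit_char_def cis_mult add_divide_distrib ring_distribs)

lemma unit_char_sum: "unit_char M (\<Sum>i\<in>A. f i) = (\<Prod>i\<in>A. unit_char M (f i))"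
  by (induction A rule: infinite_finite_induct) (auto simp: unit_char_add)

lemma cnj_unit_char: "cnj (unit_char M t) = unit_char M (- t)"
  by (simp add: unit_char_def cis_cnj)

lemma norm_unit_char [simp]: "cmod (unit_char M t) = 1"
  by (simp add: unit_char_def)

lemma unit_char_mult_modulus: "M \<noteq> 0 \<Longrightarrow> unit_char M (M * t) = 1"
proof -
  assume "M \<noteq> 0"
  then have "2 * pi * real_of_int (M * t) / real_of_int M = 2 * pi * real_of_int t" by simp
  then show ?thesis by (simp only: unit_char_def cis_multiple_2pi Ints_of_int)
qed

lemma unit_char_cancel: "K \<noteq> 0 \<Longrightarrow> unit_char (N * K) (K * t) = unit_char N t"
  by (simp add: unit_char_def field_simps)

lemma unit_char_diff_modulus: "M \<noteq> 0 \<Longrightarrow> unit_char M (t - M * s) = unit_char M t"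
  using unit_char_add[of M "t - M * s" "M * s"] by (simp add: unit_char_mult_modulus)

lemma unit_char_power: "unit_char M t ^ k = unit_char M (int k * t)"
  by (induction k) (auto simp: unit_char_add ring_distribs)

lemma unit_char_eq_1_iff:
  assumes "M > 0"
  shows "unit_char M t = 1 \<longleftrightarrow> M dvd t"
proof
  assume "unit_char M t = 1"
  then have "cos (2 * pi * real_of_int t / real_of_int M) = 1"
    by (simp add: unit_char_def cis.code complex_eq_iff)
  then obtain s :: int where "2 * pi * real_of_int t / real_of_int M = real_of_int s * 2 * pi"
    by (auto simp: cos_one_2pi_int)
  then have "real_of_int t = real_of_int (M * s)"
    using assms by (simp add: field_simps)
  then have "t = M * s" by (simp only: of_int_eq_iff)
  then show "M dvd t" by simp
qed (use assms in \<open>auto simp: unit_char_mult_modulus\<close>)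

lemma sum_unit_char_eq_0:
  assumes "M > 0" "\<not> M dvd t"
  shows "(\<Sum>k\<in>{0..<M}. unit_char M (k * t)) = 0"
proof -
  have "(\<Sum>k\<in>{0..<M}. unit_char M (k * t)) = (\<Sum>k<nat M. unit_char M t ^ k)"
    using assms by (simp add: image_atLeastZeroLessThan_int sum.reindex unit_char_power)
  also have "\<dots> = 0"
    using assms unit_char_eq_1_iff[of M t]
    by (subst geometric_sum) (auto simp: unit_char_power unit_char_mult_modulus)
  finally show ?thesis .
qed

text \<open>Jordan's inequality: the sine is concave on [0, pi/2], hence lies above its chord
  there.\<close>

lemma sin_ge_two_div_pi:
  assumes "0 \<le> t" "t \<le> pi / 2"
  shows "2 * t / pi \<le> sin t"
proof -
  have "concave_on {0..pi/2} sin"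
  proof (rule f''_le0_imp_concave)
    show "DERIV sin x :> cos x" for x :: real by (rule DERIV_sin)
    show "DERIV cos x :> - sin x" for x :: real by (rule DERIV_cos)
    show "- sin x \<le> 0" if "x \<in> {0..pi/2}" for x :: real
      using that by (auto intro: sin_ge_zero)
  qed auto
  from concave_onD[OF this, of "2 * t / pi" 0 "pi / 2"] assms show ?thesis
    by (simp add: field_simps)
qed

text \<open>The left-out quantity is a sine: |1 - exp(2 i \<theta>)| = 2 |sin \<theta>|, and
  Jordan's inequality bounds it below. Distances to 0 modulo \<open>M\<close> can thus be measured
  by characters.\<close>

lemma norm_one_minus_unit_char_ge:
  assumes "M > 0" "2 * \<bar>t\<bar> \<le> M"
  shows "16 * (real_of_int t)\<^sup>2 / (real_of_int M)\<^sup>2 \<le> (cmod (1 - unit_char M t))\<^sup>2"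
proof -
  define \<theta> where "\<theta> = pi * \<bar>real_of_int t\<bar> / real_of_int M"
  have "2 * \<bar>real_of_int t\<bar> \<le> real_of_int M" using assms(2) by linarith
  then have \<theta>: "0 \<le> \<theta>" "\<theta> \<le> pi / 2"
    using assms(1) by (auto simp: \<theta>_def field_simps)
  have norm_cis: "(cmod (1 - cis x))\<^sup>2 = 2 - 2 * cos x" for x
  proof -
    have "(cmod (1 - cis x))\<^sup>2 = (1 - cos x)\<^sup>2 + (sin x)\<^sup>2" by (simp add: cmod_power2)
    then show ?thesis using sin_cos_squared_add[of x] by (simp add: power2_diff)
  qed
  have "2 * \<theta> = \<bar>2 * pi * real_of_int t / real_of_int M\<bar>"
    using assms(1) by (simp add: \<theta>_def abs_mult)
  then have "(cmod (1 - unit_char M t))\<^sup>2 = 2 - 2 * cos (2 * \<theta>)"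
    by (simp only: unit_char_def norm_cis cos_abs_real)
  also have "2 - 2 * cos (2 * \<theta>) = (2 * sin \<theta>)\<^sup>2"
    by (simp add: cos_double_sin power_mult_distrib)
  finally have eq: "(cmod (1 - unit_char M t))\<^sup>2 = (2 * sin \<theta>)\<^sup>2" .
  have "4 * \<bar>real_of_int t\<bar> / real_of_int M \<le> 2 * sin \<theta>"
    using sin_ge_two_div_pi[OF \<theta>] by (simp add: \<theta>_def)
  then have "(4 * \<bar>real_of_int t\<bar> / real_of_int M)\<^sup>2 \<le> (2 * sin \<theta>)\<^sup>2"
    using assms by (intro power_mono) auto
  then show ?thesis by (simp add: eq power_divide power_mult_distrib)
qed

text \<open>The points k a + N l, with k below \<open>N\<close> and the entries of l below
  \<open>K\<close>, represent the classes of \<int>a + N\<int>^n modulo N K, each equally often.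
  Indexing by pairs (k, l) makes character sums factor.\<close>

definition box_point :: "int \<Rightarrow> (nat \<Rightarrow> int) \<Rightarrow> int \<times> (nat \<Rightarrow> int) \<Rightarrow> nat \<Rightarrow> int" where
  "box_point N a p i = fst p * a i + N * snd p i"

text \<open>The sum factors into a sum over k and one sum over each entry of l. The latter vanish
  unless \<open>K\<close> divides every \<open>d i\<close>. If d = K y, the sum over k vanishes
  unless \<open>N\<close> divides the inner product of a and y; in that case \<open>sep\<close>
  makes some entry of y at least \<open>R\<close>, against the bound on d.\<close>

lemma sum_unit_char_box_eq_0:
  fixes a d :: "nat \<Rightarrow> int"
  assumes "N > 0" "K > 0"
    and sep: "\<And>y. \<exists>i<n. y i \<noteq> 0 \<Longrightarrow> N dvd (\<Sum>i<n. a i * y i) \<Longrightarrow> \<exists>i<n. R \<le> \<bar>y i\<bar>"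
    and d: "\<exists>i<n. d i \<noteq> 0" "\<forall>i<n. \<bar>d i\<bar> < K * R"
  shows "(\<Sum>p\<in>{0..<N} \<times> ({..<n} \<rightarrow>\<^sub>E {0..<K}). unit_char (N * K) (\<Sum>i<n. box_point N a p i * d i)) = 0"
proof -
  have "(\<Sum>p\<in>{0..<N} \<times> ({..<n} \<rightarrow>\<^sub>E {0..<K}). unit_char (N * K) (\<Sum>i<n. box_point N a p i * d i))
    = (\<Sum>k\<in>{0..<N}. \<Sum>l\<in>{..<n} \<rightarrow>\<^sub>E {0..<K}.
         unit_char (N * K) (k * (\<Sum>i<n. a i * d i)) * (\<Prod>i<n. unit_char K (l i * d i)))"
    unfolding sum.cartesian_product'
  proof (intro sum.cong refl)
    fix k l
    have "(\<Sum>i<n. box_point N a (k, l) i * d i) = k * (\<Sum>i<n. a i * d i) + (\<Sum>i<n. N * (l i * d i))"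
      by (simp add: box_point_def ring_distribs sum.distrib sum_distrib_left mult_ac)
    then show "unit_char (N * K) (\<Sum>i<n. box_point N a (k, l) i * d i)
        = unit_char (N * K) (k * (\<Sum>i<n. a i * d i)) * (\<Prod>i<n. unit_char K (l i * d i))"
      using unit_char_cancel[of N K] assms(1) by (simp add: unit_char_add unit_char_sum mult.commute[of N K])
  qed
  also have "\<dots> = (\<Sum>k\<in>{0..<N}. unit_char (N * K) (k * (\<Sum>i<n. a i * d i)))
      * (\<Prod>i<n. \<Sum>t\<in>{0..<K}. unit_char K (t * d i))"
    by (subst prod_sum_PiE) (auto simp: sum_product)
  also have "\<dots> = 0"
  proof (cases "\<forall>i<n. K dvd d i")
    case False
    then obtain i where i: "i < n" "\<not> K dvd d i" by blast
    then have "(\<Sum>t\<in>{0..<K}. unit_char K (t * d i)) = 0"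
      using assms by (intro sum_unit_char_eq_0) auto
    then have "(\<Prod>i<n. \<Sum>t\<in>{0..<K}. unit_char K (t * d i)) = 0"
      using i by (intro prod_zero) auto
    then show ?thesis by simp
  next
    case True
    define y where "y = (\<lambda>i. d i div K)"
    have dy: "d i = K * y i" if "i < n" for i
      using True that by (simp add: y_def)
    have "\<not> N dvd (\<Sum>i<n. a i * y i)"
    proof
      assume *: "N dvd (\<Sum>i<n. a i * y i)"
      have "\<exists>i<n. y i \<noteq> 0" using d(1) dy by fastforce
      from sep[OF this *] obtain i where i: "i < n" "R \<le> \<bar>y i\<bar>" by blast
      then have "K * R \<le> \<bar>d i\<bar>"
        using assms(2) dy by (simp add: abs_mult)
      with d(2) i show False by force
    qed
    then have "(\<Sum>k\<in>{0..<N}. unit_char N (k * (\<Sum>i<n. a i * y i))) = 0"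
      using assms by (intro sum_unit_char_eq_0) auto
    moreover have "unit_char (N * K) (k * (\<Sum>i<n. a i * d i)) = unit_char N (k * (\<Sum>i<n. a i * y i))" for k
    proof -
      have "k * (\<Sum>i<n. a i * d i) = K * (k * (\<Sum>i<n. a i * y i))"
        by (simp add: dy sum_distrib_left mult_ac)
      then show ?thesis using assms(2) by (simp only: unit_char_cancel)
    qed
    ultimately show ?thesis by simp
  qed
  finally show ?thesis .
qed

text \<open>A squared modulus of a trigonometric polynomial in product form. Its frequencies are
  differences of points of the box with entries in {1..Q}, so their entries are below
  \<open>Q\<close> in absolute value. The coefficients may depend on the coordinate so that a single
  factor can be exchanged.\<close>

definition trig_weight :: "nat \<Rightarrow> nat \<Rightarrow> (nat \<Rightarrow> nat \<Rightarrow> real) \<Rightarrow> int \<Rightarrow> (nat \<Rightarrow> int) \<Rightarrow> real" where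
  "trig_weight n Q \<alpha> M x =
     (\<Prod>j<n. (cmod (\<Sum>y\<in>{1..Q}. of_real (\<alpha> j y) * unit_char M (x j * int y)))\<^sup>2)"

lemma trig_weight_nonneg: "trig_weight n Q \<alpha> M x \<ge> 0"
  by (simp add: trig_weight_def prod_nonneg)

lemma double_sum_mult_right:
  fixes r :: complex
  shows "(\<Sum>y\<in>A. \<Sum>z\<in>B. f y z) * r = (\<Sum>y\<in>A. \<Sum>z\<in>B. f y z * r)"
  by (simp add: sum_distrib_right)

lemma sum_swap3_mult:
  fixes c :: "_ \<Rightarrow> _ \<Rightarrow> complex"
  shows "(\<Sum>p\<in>X. \<Sum>y\<in>A. \<Sum>z\<in>B. c y z * f p y z) = (\<Sum>y\<in>A. \<Sum>z\<in>B. c y z * (\<Sum>p\<in>X. f p y z))"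
proof -
  have "(\<Sum>p\<in>X. \<Sum>y\<in>A. \<Sum>z\<in>B. c y z * f p y z) = (\<Sum>y\<in>A. \<Sum>p\<in>X. \<Sum>z\<in>B. c y z * f p y z)"
    by (rule sum.swap)
  also have "\<dots> = (\<Sum>y\<in>A. \<Sum>z\<in>B. \<Sum>p\<in>X. c y z * f p y z)"
    by (intro sum.cong refl sum.swap)
  finally show ?thesis by (simp add: sum_distrib_left)
qed

lemma trig_weight_expand:
  "of_real (trig_weight n Q \<alpha> M x) * unit_char M (\<Sum>i<n. x i * z i) =
    (\<Sum>y\<in>{..<n} \<rightarrow>\<^sub>E {1..Q}. \<Sum>y'\<in>{..<n} \<rightarrow>\<^sub>E {1..Q}.
       of_real (\<Prod>j<n. \<alpha> j (y j) * \<alpha> j (y' j)) *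
       unit_char M (\<Sum>i<n. x i * (int (y i) - int (y' i) + z i)))"
proof -
  define P where "P = (\<Prod>j<n. \<Sum>y\<in>{1..Q}. of_real (\<alpha> j y) * unit_char M (x j * int y))"
  have P: "P = (\<Sum>y\<in>{..<n} \<rightarrow>\<^sub>E {1..Q}. of_real (\<Prod>j<n. \<alpha> j (y j)) * unit_char M (\<Sum>i<n. x i * int (y i)))"
    unfolding P_def by (subst prod_sum_PiE) (auto simp: prod.distrib unit_char_sum)
  have "trig_weight n Q \<alpha> M x = (cmod P)\<^sup>2"
    unfolding P_def trig_weight_def by (subst prod_norm[symmetric]) (rule prod_power_distrib[symmetric])
  then have "of_real (trig_weight n Q \<alpha> M x) = P * cnj P"
    by (simp only: complex_norm_square)
  also have "\<dots> = (\<Sum>y\<in>{..<n} \<rightarrow>\<^sub>E {1..Q}. \<Sum>y'\<in>{..<n} \<rightarrow>\<^sub>E {1..Q}.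
       (of_real (\<Prod>j<n. \<alpha> j (y j)) * unit_char M (\<Sum>i<n. x i * int (y i))) *
       (of_real (\<Prod>j<n. \<alpha> j (y' j)) * unit_char M (- (\<Sum>i<n. x i * int (y' i)))))"
  proof -
    have cnj_P: "cnj P = (\<Sum>y\<in>{..<n} \<rightarrow>\<^sub>E {1..Q}. of_real (\<Prod>j<n. \<alpha> j (y j)) * unit_char M (- (\<Sum>i<n. x i * int (y i))))"
      unfolding P by (simp only: cnj_sum complex_cnj_mult complex_cnj_complex_of_real cnj_unit_char)
    show ?thesis unfolding cnj_P unfolding P by (rule sum_product)
  qed
  finally have "of_real (trig_weight n Q \<alpha> M x) * unit_char M (\<Sum>i<n. x i * z i)
     = (\<Sum>y\<in>{..<n} \<rightarrow>\<^sub>E {1..Q}. \<Sum>y'\<in>{..<n} \<rightarrow>\<^sub>E {1..Q}.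
       ((of_real (\<Prod>j<n. \<alpha> j (y j)) * unit_char M (\<Sum>i<n. x i * int (y i))) *
       (of_real (\<Prod>j<n. \<alpha> j (y' j)) * unit_char M (- (\<Sum>i<n. x i * int (y' i)))))
        * unit_char M (\<Sum>i<n. x i * z i))"
    by (simp only: double_sum_mult_right)
  also have "\<dots> = (\<Sum>y\<in>{..<n} \<rightarrow>\<^sub>E {1..Q}. \<Sum>y'\<in>{..<n} \<rightarrow>\<^sub>E {1..Q}.
       of_real (\<Prod>j<n. \<alpha> j (y j) * \<alpha> j (y' j)) *
       unit_char M (\<Sum>i<n. x i * (int (y i) - int (y' i) + z i)))"
  proof (intro sum.cong refl)
    fix y y' :: "nat \<Rightarrow> nat"
    have "(\<Sum>i<n. x i * (int (y i) - int (y' i) + z i)) =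
       (\<Sum>i<n. x i * int (y i)) + - (\<Sum>i<n. x i * int (y' i)) + (\<Sum>i<n. x i * z i)"
      by (simp add: algebra_simps sum.distrib sum_subtractf)
    then show "of_real (\<Prod>j<n. \<alpha> j (y j)) * unit_char M (\<Sum>i<n. x i * int (y i)) *
       (of_real (\<Prod>j<n. \<alpha> j (y' j)) * unit_char M (- (\<Sum>i<n. x i * int (y' i))))
        * unit_char M (\<Sum>i<n. x i * z i) = of_real (\<Prod>j<n. \<alpha> j (y j) * \<alpha> j (y' j)) *
       unit_char M (\<Sum>i<n. x i * (int (y i) - int (y' i) + z i))"
      by (simp only: unit_char_add) (simp add: prod.distrib)
  qed
  finally show ?thesis .
qed

lemma sum_trig_weight_unit_char:
  "(\<Sum>p\<in>X. of_real (trig_weight n Q \<alpha> M (x p)) * unit_char M (\<Sum>i<n. x p i * z i)) =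
    (\<Sum>y\<in>{..<n} \<rightarrow>\<^sub>E {1..Q}. \<Sum>y'\<in>{..<n} \<rightarrow>\<^sub>E {1..Q}.
       of_real (\<Prod>j<n. \<alpha> j (y j) * \<alpha> j (y' j)) *
       (\<Sum>p\<in>X. unit_char M (\<Sum>i<n. x p i * (int (y i) - int (y' i) + z i))))"
proof -
  have "(\<Sum>p\<in>X. of_real (trig_weight n Q \<alpha> M (x p)) * unit_char M (\<Sum>i<n. x p i * z i)) =
    (\<Sum>p\<in>X. \<Sum>y\<in>{..<n} \<rightarrow>\<^sub>E {1..Q}. \<Sum>y'\<in>{..<n} \<rightarrow>\<^sub>E {1..Q}.
       of_real (\<Prod>j<n. \<alpha> j (y j) * \<alpha> j (y' j)) *
       unit_char M (\<Sum>i<n. x p i * (int (y i) - int (y' i) + z i)))"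
    by (rule sum.cong[OF refl]) (rule trig_weight_expand[where \<alpha> = \<alpha> and x = "x _"])
  then show ?thesis
    by (simp only: sum_swap3_mult)
qed

text \<open>Parseval: after expansion, \<open>orth\<close> removes all pairs of frequencies except
  the diagonal ones.\<close>

lemma sum_trig_weight:
  fixes x :: "'b \<Rightarrow> nat \<Rightarrow> int"
  assumes orth: "\<And>d. \<exists>i<n. d i \<noteq> 0 \<Longrightarrow> \<forall>i<n. \<bar>d i\<bar> < 2 * int Q \<Longrightarrow>
      (\<Sum>p\<in>X. unit_char M (\<Sum>i<n. x p i * d i)) = 0"
  shows "(\<Sum>p\<in>X. trig_weight n Q \<alpha> M (x p)) = real (card X) * (\<Prod>j<n. \<Sum>y\<in>{1..Q}. (\<alpha> j y)\<^sup>2)"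
proof -
  let ?B = "{..<n} \<rightarrow>\<^sub>E {1..Q}"
  have "complex_of_real (\<Sum>p\<in>X. trig_weight n Q \<alpha> M (x p)) =
     (\<Sum>p\<in>X. of_real (trig_weight n Q \<alpha> M (x p)) * unit_char M (\<Sum>i<n. x p i * 0))"
    by simp
  also have "\<dots> = (\<Sum>y\<in>?B. \<Sum>y'\<in>?B. of_real (\<Prod>j<n. \<alpha> j (y j) * \<alpha> j (y' j)) *
       (\<Sum>p\<in>X. unit_char M (\<Sum>i<n. x p i * (int (y i) - int (y' i) + 0))))"
    by (rule sum_trig_weight_unit_char[where \<alpha> = \<alpha> and x = x and z = "\<lambda>_. 0"])
  also have "\<dots> = (\<Sum>y\<in>?B. \<Sum>y'\<in>?B. if y' = y then of_real ((\<Prod>j<n. (\<alpha> j (y j))\<^sup>2) * real (card X)) else 0)"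
  proof (intro sum.cong refl)
    fix y y' assume y: "y \<in> ?B" "y' \<in> ?B"
    show "of_real (\<Prod>j<n. \<alpha> j (y j) * \<alpha> j (y' j)) *
       (\<Sum>p\<in>X. unit_char M (\<Sum>i<n. x p i * (int (y i) - int (y' i) + 0)))
      = (if y' = y then of_real ((\<Prod>j<n. (\<alpha> j (y j))\<^sup>2) * real (card X)) else 0)"
    proof (cases "y' = y")
      case True
      then show ?thesis by (simp add: power2_eq_square)
    next
      case False
      have "(\<Sum>p\<in>X. unit_char M (\<Sum>i<n. x p i * (int (y i) - int (y' i) + 0))) = 0"
      proof (rule orth)
        show "\<exists>i<n. int (y i) - int (y' i) + 0 \<noteq> 0"
        proof (rule ccontr)
          assume "\<not> ?thesis"
          then have "y' = y"
            by (intro PiE_ext[OF y(2) y(1)]) simp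
          with False show False by simp
        qed
        show "\<forall>i<n. \<bar>int (y i) - int (y' i) + 0\<bar> < 2 * int Q"
        proof (intro allI impI)
          fix i assume "i < n"
          then have "y i \<in> {1..Q}" "y' i \<in> {1..Q}" using y[THEN PiE_mem, of i] by auto
          then show "\<bar>int (y i) - int (y' i) + 0\<bar> < 2 * int Q" by auto
        qed
      qed
      with False show ?thesis by simp
    qed
  qed
  also have "\<dots> = (\<Sum>y\<in>?B. of_real ((\<Prod>j<n. (\<alpha> j (y j))\<^sup>2) * real (card X)))"
    by (simp add: sum.delta finite_PiE cong: sum.cong)
  also have "\<dots> = of_real (\<Sum>y\<in>?B. (\<Prod>j<n. (\<alpha> j (y j))\<^sup>2) * real (card X))"
    by simp
  also have "(\<Sum>y\<in>?B. (\<Prod>j<n. (\<alpha> j (y j))\<^sup>2) * real (card X)) =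
      real (card X) * (\<Prod>j<n. \<Sum>y\<in>{1..Q}. (\<alpha> j y)\<^sup>2)"
    by (subst prod_sum_PiE) (auto simp: sum_distrib_left mult.commute)
  finally show ?thesis by (simp only: of_real_eq_iff)
qed

text \<open>Every frequency has entries below \<open>Q\<close> in absolute value, while
  \<open>z\<close> attains \<open>Q\<close> at coordinate \<open>j\<close>. The shifted frequency is
  therefore nonzero at \<open>j\<close> but still below 2 Q everywhere, so \<open>orth\<close>
  removes every term.\<close>

lemma sum_trig_weight_shifted:
  fixes x :: "'b \<Rightarrow> nat \<Rightarrow> int"
  assumes orth: "\<And>d. \<exists>i<n. d i \<noteq> 0 \<Longrightarrow> \<forall>i<n. \<bar>d i\<bar> < 2 * int Q \<Longrightarrow>
      (\<Sum>p\<in>X. unit_char M (\<Sum>i<n. x p i * d i)) = 0"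
    and z: "\<forall>i<n. \<bar>z i\<bar> \<le> int Q" "j < n" "\<bar>z j\<bar> = int Q"
  shows "(\<Sum>p\<in>X. of_real (trig_weight n Q \<alpha> M (x p)) * unit_char M (\<Sum>i<n. x p i * z i)) = 0"
proof -
  let ?B = "{..<n} \<rightarrow>\<^sub>E {1..Q}"
  have "(\<Sum>p\<in>X. of_real (trig_weight n Q \<alpha> M (x p)) * unit_char M (\<Sum>i<n. x p i * z i)) =
     (\<Sum>y\<in>?B. \<Sum>y'\<in>?B. of_real (\<Prod>j<n. \<alpha> j (y j) * \<alpha> j (y' j)) *
       (\<Sum>p\<in>X. unit_char M (\<Sum>i<n. x p i * (int (y i) - int (y' i) + z i))))"
    by (rule sum_trig_weight_unit_char[where \<alpha> = \<alpha> and x = x and z = z])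
  also have "\<dots> = 0"
  proof (intro sum.neutral ballI)
    fix y y' assume y: "y \<in> ?B" "y' \<in> ?B"
    have bnd: "y i \<in> {1..Q}" "y' i \<in> {1..Q}" if "i < n" for i
      using y[THEN PiE_mem, of i] that by auto
    have "(\<Sum>p\<in>X. unit_char M (\<Sum>i<n. x p i * (int (y i) - int (y' i) + z i))) = 0"
    proof (rule orth)
      show "\<exists>i<n. int (y i) - int (y' i) + z i \<noteq> 0"
        using bnd[OF z(2)] z(2,3) by (intro exI[of _ j]) auto
      show "\<forall>i<n. \<bar>int (y i) - int (y' i) + z i\<bar> < 2 * int Q"
      proof (intro allI impI)
        fix i assume "i < n"
        then show "\<bar>int (y i) - int (y' i) + z i\<bar> < 2 * int Q"
          using bnd[of i] z(1)[rule_format, of i] by auto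
      qed
    qed
    then show "of_real (\<Prod>j<n. \<alpha> j (y j) * \<alpha> j (y' j)) *
       (\<Sum>p\<in>X. unit_char M (\<Sum>i<n. x p i * (int (y i) - int (y' i) + z i))) = 0" by simp
  qed
  finally show ?thesis .
qed

text \<open>Summation by parts; the boundary terms disappear since \<phi> vanishes at 0 and at
  \<open>Q\<close>.\<close>

lemma sum_by_parts_unit_char:
  fixes \<phi> :: "nat \<Rightarrow> real"
  assumes "\<phi> 0 = 0" "\<phi> Q = 0" "Q > 0"
  shows "(\<Sum>y\<in>{1..Q}. of_real (\<phi> y - \<phi> (y - 1)) * unit_char M (t * int y)) =
    (1 - unit_char M t) * (\<Sum>y\<in>{1..Q}. of_real (\<phi> y) * unit_char M (t * int y))"
proof -
  let ?f = "\<lambda>y. complex_of_real (\<phi> y) * unit_char M (t * int y)"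
  have "(\<Sum>y\<in>{1..Q}. of_real (\<phi> (y - 1)) * unit_char M (t * int y)) =
      (\<Sum>y\<in>{0..<Q}. of_real (\<phi> y) * unit_char M (t * int (Suc y)))"
    by (rule sum.reindex_bij_witness[of _ Suc "\<lambda>y. y - 1"]) auto
  also have "\<dots> = unit_char M t * (\<Sum>y\<in>{0..<Q}. ?f y)"
    by (simp add: sum_distrib_left ring_distribs unit_char_add mult_ac)
  also have "(\<Sum>y\<in>{0..<Q}. ?f y) = (\<Sum>y\<in>{1..Q}. ?f y)"
  proof -
    have "(\<Sum>y\<in>{0..<Q}. ?f y) = (\<Sum>y\<in>{0..Q}. ?f y)"
      using assms by (intro sum.mono_neutral_left) (auto simp: not_less le_less)
    also have "\<dots> = (\<Sum>y\<in>{1..Q}. ?f y)"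
      using assms by (intro sum.mono_neutral_right) (auto simp: not_le Suc_le_eq)
    finally show ?thesis .
  qed
  finally show ?thesis
    by (simp add: algebra_simps sum_subtractf)
qed

text \<open>The upper limit \<open>m\<close> is kept apart from \<open>q\<close> so that induction
  on \<open>m\<close> applies; both are set to \<open>Q\<close> in the end.\<close>

lemma sum_sq_parabola:
  "(\<Sum>y\<in>{1..m}. (real y * (q - real y))\<^sup>2) =
    q\<^sup>2 * (real m * (real m + 1) * (2 * real m + 1)) / 6 - 2 * q * (real m * (real m + 1))\<^sup>2 / 4
    + real m * (real m + 1) * (2 * real m + 1) * (3 * (real m)\<^sup>2 + 3 * real m - 1) / 30"
proof (induction m)
  case (Suc m)
  show ?case
    unfolding sum.cl_ivl_Suc Suc by (simp add: field_simps power2_eq_square)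
qed simp

lemma sum_sq_diff_parabola:
  "(\<Sum>y\<in>{1..m}. (q + 1 - 2 * real y)\<^sup>2) =
    (q + 1)\<^sup>2 * real m - 2 * (q + 1) * real m * (real m + 1)
    + 2 * (real m * (real m + 1) * (2 * real m + 1)) / 3"
proof (induction m)
  case (Suc m)
  show ?case
    unfolding sum.cl_ivl_Suc Suc by (simp add: field_simps power2_eq_square)
qed simp

text \<open>The parabola \<open>y (Q - y)\<close> is a near-optimal discrete test function for the Rayleigh quotient.\<close>
lemma parabola_rayleigh:
  fixes Q :: nat
  assumes "Q \<ge> 2"
  defines "\<phi> \<equiv> \<lambda>y. real y * (real Q - real y)"
  shows "(\<Sum>y\<in>{1..Q}. (\<phi> y)\<^sup>2) > 0"
    and "(\<Sum>y\<in>{1..Q}. (\<phi> y - \<phi> (y - 1))\<^sup>2) \<le> 10 / (real Q)\<^sup>2 * (\<Sum>y\<in>{1..Q}. (\<phi> y)\<^sup>2)"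
proof -
  let ?q = "real Q"
  have A: "(\<Sum>y\<in>{1..Q}. (\<phi> y)\<^sup>2) = ?q * (?q ^ 4 - 1) / 30"
    unfolding \<phi>_def sum_sq_parabola by (simp add: field_simps power2_eq_square power4_eq_xxxx)
  have diff: "\<phi> y - \<phi> (y - 1) = ?q + 1 - 2 * real y" if "y \<in> {1..Q}" for y
  proof -
    have "real (y - 1) = real y - 1" using that by auto
    then show ?thesis by (simp add: \<phi>_def algebra_simps)
  qed
  have D: "(\<Sum>y\<in>{1..Q}. (\<phi> y - \<phi> (y - 1))\<^sup>2) = ?q * (?q\<^sup>2 - 1) / 3"
  proof -
    have "(\<Sum>y\<in>{1..Q}. (\<phi> y - \<phi> (y - 1))\<^sup>2) = (\<Sum>y\<in>{1..Q}. (?q + 1 - 2 * real y)\<^sup>2)"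
      by (intro sum.cong refl) (simp only: diff)
    then show ?thesis
      unfolding sum_sq_diff_parabola by (simp add: field_simps power2_eq_square)
  qed
  have q: "?q \<ge> 2" using assms by simp
  then have "1 < ?q ^ 4" by (intro one_less_power) auto
  with q show "(\<Sum>y\<in>{1..Q}. (\<phi> y)\<^sup>2) > 0"
    unfolding A by simp
  \<comment> \<open>The exact quotient of the two sums is 10 / (Q^2 + 1). The constant 10 replaces
    the optimal pi^2 of the continuous problem.\<close>
  have "10 / ?q\<^sup>2 * (?q * (?q ^ 4 - 1) / 30) = (?q ^ 4 - 1) / (3 * ?q)"
    using q by (simp add: field_simps power2_eq_square)
  moreover have "?q * (?q\<^sup>2 - 1) / 3 \<le> (?q ^ 4 - 1) / (3 * ?q)"
  proof -
    have "1 \<le> ?q\<^sup>2" using q by (simp add: one_le_power)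
    then have "(?q * (?q\<^sup>2 - 1)) * ?q \<le> ?q ^ 4 - 1"
      by (simp add: algebra_simps power2_eq_square power4_eq_xxxx)
    then show ?thesis using q by (simp add: field_simps)
  qed
  ultimately show "(\<Sum>y\<in>{1..Q}. (\<phi> y - \<phi> (y - 1))\<^sup>2) \<le> 10 / (real Q)\<^sup>2 * (\<Sum>y\<in>{1..Q}. (\<phi> y)\<^sup>2)"
    unfolding A D by simp
qed

text \<open>Summation by parts in coordinate \<open>i\<close> absorbs the factor into the weight, so
  that second moments can again be evaluated by \<open>sum_trig_weight\<close>.\<close>

lemma trig_weight_mult_diff:
  fixes \<phi> :: "nat \<Rightarrow> real"
  assumes "\<phi> 0 = 0" "\<phi> Q = 0" "Q > 0" "i < n"
  shows "trig_weight n Q (\<lambda>_. \<phi>) M x * (cmod (1 - unit_char M (x i)))\<^sup>2 =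
    trig_weight n Q (\<lambda>j. if j = i then (\<lambda>y. \<phi> y - \<phi> (y - 1)) else \<phi>) M x"
proof -
  have split: "{..<n} = insert i ({..<n} - {i})" using assms by auto
  let ?g = "\<lambda>\<psi> j. (cmod (\<Sum>y\<in>{1..Q}. of_real (\<psi> y) * unit_char M (x j * int y)))\<^sup>2"
  have "trig_weight n Q (\<lambda>j. if j = i then (\<lambda>y. \<phi> y - \<phi> (y - 1)) else \<phi>) M x
      = ?g (\<lambda>y. \<phi> y - \<phi> (y - 1)) i * (\<Prod>j\<in>{..<n} - {i}. ?g \<phi> j)"
    unfolding trig_weight_def by (subst split, subst prod.insert) (auto intro!: prod.cong)
  also have "?g (\<lambda>y. \<phi> y - \<phi> (y - 1)) i = (cmod (1 - unit_char M (x i)))\<^sup>2 * ?g \<phi> i"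
    by (subst sum_by_parts_unit_char[OF assms(1-3)]) (simp add: norm_mult power_mult_distrib)
  also have "(cmod (1 - unit_char M (x i)))\<^sup>2 * ?g \<phi> i * (\<Prod>j\<in>{..<n} - {i}. ?g \<phi> j)
     = (cmod (1 - unit_char M (x i)))\<^sup>2 * trig_weight n Q (\<lambda>_. \<phi>) M x"
    unfolding trig_weight_def by (subst (2) split, subst prod.insert) auto
  finally show ?thesis by (simp add: mult.commute)
qed

text \<open>
  A transference bound: if the vectors orthogonal to \<open>a\<close> modulo \<open>N\<close> are long, then the short vectors
  of \<open>\<int>a + N\<int>\<^sup>n\<close> lie in no hyperplane. Average a nonnegative trigonometric polynomial \<open>F\<close>, whose
  frequencies fit between the vectors of the dual lattice, over representatives of \<open>\<int>a + N\<int>\<^sup>n\<close> modulo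
  a multiple of \<open>N\<close>. A character orthogonal to the hyperplane and half-way between dual vectors has
  \<open>F\<close>-average zero, so a positive proportion of the \<open>F\<close>-mass is carried by points off the hyperplane;
  the second moment of \<open>F\<close> shows that these cannot all be long.
\<close>
lemma short_vector_off_hyperplane:
  fixes a w :: "nat \<Rightarrow> int" and N R :: int and T :: real
  assumes "N > 0" "R > 0"
    and sep: "\<And>y. \<exists>i<n. y i \<noteq> 0 \<Longrightarrow> N dvd (\<Sum>i<n. a i * y i) \<Longrightarrow> \<exists>i<n. R \<le> \<bar>y i\<bar>"
    and w: "\<exists>i<n. w i \<noteq> 0"
    and T: "5 * real n * (of_int N)\<^sup>2 / (of_int R)\<^sup>2 < T"
  shows "\<exists>k x. (\<forall>i<n. [x i = k * a i] (mod N)) \<and> (\<Sum>i<n. x i * w i) \<noteq> 0 \<and>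
    of_int (\<Sum>i<n. (x i)\<^sup>2) \<le> T"
proof (rule ccontr)
  assume "\<not> ?thesis"
  then have short: "(\<Sum>i<n. x i * w i) = 0"
    if "\<And>i. i < n \<Longrightarrow> [x i = k * a i] (mod N)" "of_int (\<Sum>i<n. (x i)\<^sup>2) \<le> T" for k x
    using that by blast
  have n: "n > 0" using w by auto
  define W where "W = Max ((\<lambda>i. \<bar>w i\<bar>) ` {..<n})"
  have "W \<in> (\<lambda>i. \<bar>w i\<bar>) ` {..<n}"
    unfolding W_def using n by (intro Max_in) (auto simp: lessThan_empty_iff)
  then obtain j0 where j0: "j0 < n" "\<bar>w j0\<bar> = W" by auto
  have W_ge: "\<bar>w i\<bar> \<le> W" if "i < n" for i
    unfolding W_def using that by (intro Max_ge) auto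
  have "W > 0" using w W_ge by fastforce
  \<comment> \<open>The choices \<open>K\<close> = 4 W, \<open>Q\<close> = 2 R W and
    \<open>z\<close> = 2 R w give 2 Q = K R, the range of frequencies in which orthogonality holds,
    and make \<open>Q\<close> the sup norm of \<open>z\<close>, as the shifted sum requires.\<close>
  define K where "K = 4 * W"
  define M where "M = N * K"
  define Q where "Q = nat (2 * R * W)"
  define z where "z = (\<lambda>i. 2 * R * w i)"
  define X where "X = {0..<N} \<times> ({..<n} \<rightarrow>\<^sub>E {0..<K})"
  define x where "x = box_point N a"
  \<comment> \<open>This is the representative of \<open>x p\<close> modulo \<open>M\<close> closest
    to 0, with entries at most M/2 in absolute value.\<close>
  define c where "c = (\<lambda>p i. x p i - M * round (real_of_int (x p i) / real_of_int M))"
  define \<phi> where "\<phi> = (\<lambda>y. real y * (real Q - real y))"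
  define F where "F = (\<lambda>p. trig_weight n Q (\<lambda>_. \<phi>) M (x p))"
  define A where "A = (\<Sum>y\<in>{1..Q}. (\<phi> y)\<^sup>2)"
  define D where "D = (\<Sum>y\<in>{1..Q}. (\<phi> y - \<phi> (y - 1))\<^sup>2)"
  define S where "S = sum F X"
  have "K > 0" "M > 0" using \<open>W > 0\<close> assms by (auto simp: K_def M_def)
  have intQ: "int Q = 2 * R * W" using \<open>W > 0\<close> assms by (simp add: Q_def)
  have "2 * int Q = K * R" by (simp add: intQ K_def)
  have "R * W \<ge> 1" using \<open>W > 0\<close> \<open>R > 0\<close> by (simp add: int_one_le_iff_zero_less)
  then have "Q \<ge> 2" using intQ by linarith
  have "T > 0"
    by (rule le_less_trans[OF _ T]) simp
  have orth: "(\<Sum>p\<in>X. unit_char M (\<Sum>i<n. x p i * d i)) = 0"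
    if "\<exists>i<n. d i \<noteq> 0" "\<forall>i<n. \<bar>d i\<bar> < 2 * int Q" for d
    unfolding X_def M_def x_def
    using that \<open>2 * int Q = K * R\<close> by (intro sum_unit_char_box_eq_0[OF \<open>N > 0\<close> \<open>K > 0\<close> sep]) auto
  have S: "S = real (card X) * A ^ n"
    unfolding S_def F_def A_def by (subst sum_trig_weight[OF orth]) auto
  have "X \<noteq> {}" using \<open>N > 0\<close> \<open>K > 0\<close> by (auto simp: X_def PiE_eq_empty_iff)
  moreover have "finite X" by (auto simp: X_def intro: finite_PiE)
  ultimately have "card X > 0" by (simp add: card_gt_0_iff)
  have A_pos: "A > 0" and DA: "D \<le> 10 / (real Q)\<^sup>2 * A"
    unfolding A_def D_def \<phi>_def using parabola_rayleigh[OF \<open>Q \<ge> 2\<close>] by auto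
  have "S > 0" using \<open>card X > 0\<close> A_pos by (simp add: S)
  have second: "(\<Sum>p\<in>X. F p * (cmod (1 - unit_char M (x p i)))\<^sup>2) \<le> 10 / (real Q)\<^sup>2 * S" if "i < n" for i
  proof -
    let ?\<alpha> = "\<lambda>j. if j = i then (\<lambda>y. \<phi> y - \<phi> (y - 1)) else \<phi>"
    have "(\<Sum>p\<in>X. F p * (cmod (1 - unit_char M (x p i)))\<^sup>2) = (\<Sum>p\<in>X. trig_weight n Q ?\<alpha> M (x p))"
      unfolding F_def using \<open>Q \<ge> 2\<close> that
      by (intro sum.cong refl trig_weight_mult_diff) (auto simp: \<phi>_def)
    also have "\<dots> = real (card X) * (\<Prod>j<n. \<Sum>y\<in>{1..Q}. (?\<alpha> j y)\<^sup>2)"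
      by (rule sum_trig_weight[OF orth])
    also have "(\<Prod>j<n. \<Sum>y\<in>{1..Q}. (?\<alpha> j y)\<^sup>2) = (\<Prod>j<n. if j = i then D else A)"
      by (intro prod.cong refl) (auto simp: A_def D_def)
    also have "\<dots> = D * A ^ (n - 1)"
      using that by (subst prod.remove[of _ i]) (auto simp: prod.If_cases)
    also have "real (card X) * (D * A ^ (n - 1)) \<le> real (card X) * ((10 / (real Q)\<^sup>2 * A) * A ^ (n - 1))"
      using DA A_pos by (intro mult_left_mono mult_right_mono) auto
    also have "\<dots> = 10 / (real Q)\<^sup>2 * S"
      unfolding S using n by (subst power_eq_if[of A n]) simp
    finally show ?thesis .
  qed
  have c_le: "(real_of_int (c p i))\<^sup>2 \<le> (real_of_int M)\<^sup>2 / 16 * (cmod (1 - unit_char M (x p i)))\<^sup>2" for p i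
  proof -
    have "\<bar>real_of_int (x p i) / real_of_int M - real_of_int (round (real_of_int (x p i) / real_of_int M))\<bar> \<le> 1 / 2"
      using of_int_round_abs_le[of "real_of_int (x p i) / real_of_int M"] by (simp add: abs_minus_commute)
    then have "real_of_int M * \<bar>real_of_int (x p i) / real_of_int M - real_of_int (round (real_of_int (x p i) / real_of_int M))\<bar>
        \<le> real_of_int M * (1 / 2)"
      using \<open>M > 0\<close> by (intro mult_left_mono) auto
    also have "real_of_int M * \<bar>real_of_int (x p i) / real_of_int M - real_of_int (round (real_of_int (x p i) / real_of_int M))\<bar>
        = \<bar>real_of_int M * (real_of_int (x p i) / real_of_int M - real_of_int (round (real_of_int (x p i) / real_of_int M)))\<bar>"
      using \<open>M > 0\<close> by (simp add: abs_mult)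
    also have "\<dots> = \<bar>real_of_int (c p i)\<bar>"
      using \<open>M > 0\<close> by (simp add: c_def right_diff_distrib)
    finally have "2 * \<bar>c p i\<bar> \<le> M" by linarith
    from norm_one_minus_unit_char_ge[OF \<open>M > 0\<close> this] have
      "16 * (real_of_int (c p i))\<^sup>2 / (real_of_int M)\<^sup>2 \<le> (cmod (1 - unit_char M (x p i)))\<^sup>2"
      using \<open>M > 0\<close> by (simp add: c_def unit_char_diff_modulus)
    then show ?thesis using \<open>M > 0\<close> by (simp add: field_simps)
  qed
  \<comment> \<open>A short \<open>c p\<close> lies in the hyperplane by \<open>short\<close>, so
    the character equals 1 and the left side is 0. For a long one the right side is at least 2,
    which bounds the left side trivially.\<close>
  have cos_le: "1 - Re (unit_char M (\<Sum>i<n. x p i * z i)) \<le> 2 / T * (\<Sum>i<n. (real_of_int (c p i))\<^sup>2)" for p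
  proof (cases "of_int (\<Sum>i<n. (c p i)\<^sup>2) \<le> T")
    case True
    have "(\<Sum>i<n. c p i * w i) = 0"
    proof (rule short[OF _ True])
      fix i
      have "c p i = fst p * a i + N * (snd p i - K * round (real_of_int (x p i) / real_of_int M))"
        by (simp add: c_def x_def box_point_def M_def algebra_simps)
      then show "[c p i = fst p * a i] (mod N)" by (simp add: cong_def)
    qed
    then have "(\<Sum>i<n. c p i * z i) = 0"
      by (simp add: z_def mult.left_commute[of _ "2 * R"] flip: sum_distrib_left)
    moreover have "(\<Sum>i<n. c p i * z i) = (\<Sum>i<n. x p i * z i) - M * (\<Sum>i<n. round (real_of_int (x p i) / real_of_int M) * z i)"
      by (simp add: c_def left_diff_distrib sum_subtractf sum_distrib_left mult.assoc)
    ultimately have "unit_char M (\<Sum>i<n. x p i * z i) = 1"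
      using unit_char_diff_modulus[of M "\<Sum>i<n. x p i * z i"] \<open>M > 0\<close> by (metis less_irrefl unit_char_0)
    then show ?thesis using \<open>T > 0\<close> by (simp add: sum_nonneg)
  next
    case False
    have "1 - Re (unit_char M (\<Sum>i<n. x p i * z i)) \<le> 2"
      using abs_Re_le_cmod[of "unit_char M (\<Sum>i<n. x p i * z i)"] by simp
    also have "2 \<le> 2 / T * (\<Sum>i<n. (real_of_int (c p i))\<^sup>2)"
      using False \<open>T > 0\<close> by (simp add: field_simps)
    finally show ?thesis .
  qed
  have "(\<Sum>p\<in>X. of_real (F p) * unit_char M (\<Sum>i<n. x p i * z i)) = 0"
    unfolding F_def
  proof (rule sum_trig_weight_shifted[OF orth])
    show "\<forall>i<n. \<bar>z i\<bar> \<le> int Q"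
      using W_ge \<open>R > 0\<close> by (auto simp: z_def intQ abs_mult)
    show "j0 < n" by (fact j0)
    show "\<bar>z j0\<bar> = int Q" using j0 \<open>R > 0\<close> by (simp add: z_def intQ abs_mult)
  qed
  from arg_cong[OF this, of Re] have "(\<Sum>p\<in>X. F p * Re (unit_char M (\<Sum>i<n. x p i * z i))) = 0"
    by simp
  then have "S = (\<Sum>p\<in>X. F p * (1 - Re (unit_char M (\<Sum>i<n. x p i * z i))))"
    by (simp add: S_def right_diff_distrib sum_subtractf)
  also have "\<dots> \<le> (\<Sum>p\<in>X. F p * (2 / T * (\<Sum>i<n. (real_of_int M)\<^sup>2 / 16 * (cmod (1 - unit_char M (x p i)))\<^sup>2)))"
  proof (intro sum_mono mult_left_mono)
    fix p
    have "(\<Sum>i<n. (real_of_int (c p i))\<^sup>2) \<le> (\<Sum>i<n. (real_of_int M)\<^sup>2 / 16 * (cmod (1 - unit_char M (x p i)))\<^sup>2)"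
      by (intro sum_mono c_le)
    then have "2 / T * (\<Sum>i<n. (real_of_int (c p i))\<^sup>2)
      \<le> 2 / T * (\<Sum>i<n. (real_of_int M)\<^sup>2 / 16 * (cmod (1 - unit_char M (x p i)))\<^sup>2)"
      using \<open>T > 0\<close> by (intro mult_left_mono) auto
    with cos_le[of p] show "1 - Re (unit_char M (\<Sum>i<n. x p i * z i)) \<le>
        2 / T * (\<Sum>i<n. (real_of_int M)\<^sup>2 / 16 * (cmod (1 - unit_char M (x p i)))\<^sup>2)"
      by (rule order.trans)
    show "0 \<le> F p" by (simp add: F_def trig_weight_nonneg)
  qed
  also have "\<dots> = (real_of_int M)\<^sup>2 / (8 * T) * (\<Sum>p\<in>X. \<Sum>i<n. F p * (cmod (1 - unit_char M (x p i)))\<^sup>2)"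
    by (simp add: sum_distrib_left) (simp add: field_simps)
  also have "\<dots> = (real_of_int M)\<^sup>2 / (8 * T) * (\<Sum>i<n. \<Sum>p\<in>X. F p * (cmod (1 - unit_char M (x p i)))\<^sup>2)"
    by (subst sum.swap) (rule refl)
  also have "\<dots> \<le> (real_of_int M)\<^sup>2 / (8 * T) * (\<Sum>i<n. 10 / (real Q)\<^sup>2 * S)"
    using \<open>T > 0\<close> by (intro mult_left_mono sum_mono second) auto
  \<comment> \<open>Here M / Q = 2 N / R, and the constant is 10 * 4 / 8 = 5.\<close>
  also have "\<dots> = (5 * real n * (of_int N)\<^sup>2 / (of_int R)\<^sup>2) * S / T"
  proof -
    have "real Q = 2 * of_int R * of_int W"
      using arg_cong[OF intQ, of real_of_int] by simp
    then show ?thesis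
      using \<open>W > 0\<close> \<open>R > 0\<close> \<open>T > 0\<close> by (simp add: M_def K_def field_simps power2_eq_square)
  qed
  also have "\<dots> < T * S / T"
    using T \<open>S > 0\<close> \<open>T > 0\<close> by (intro divide_strict_right_mono mult_strict_right_mono) auto
  also have "\<dots> = S" using \<open>T > 0\<close> by simp
  finally show False by simp
qed

section \<open>Counting coefficient vectors with a short orthogonal vector\<close>

lemma bezout_Gcd_family:
  fixes y :: "nat \<Rightarrow> int"
  shows "\<exists>c. (\<Sum>i<n. c i * y i) = Gcd (y ` {..<n})"
proof (induction n)
  case (Suc n)
  then obtain c where c: "(\<Sum>i<n. c i * y i) = Gcd (y ` {..<n})" by blast
  obtain u v where uv: "u * y n + v * Gcd (y ` {..<n}) = gcd (y n) (Gcd (y ` {..<n}))"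
    using bezout_int by blast
  have "(\<Sum>i<Suc n. (if i = n then u else v * c i) * y i) = v * (\<Sum>i<n. c i * y i) + u * y n"
    by (simp add: sum_distrib_left mult_ac)
  also have "\<dots> = Gcd (y ` {..<Suc n})"
    using uv by (simp add: c lessThan_Suc algebra_simps)
  finally show ?case by (intro exI[of _ "\<lambda>i. if i = n then u else v * c i"])
qed simp

lemma finite_coeff_vectors: "finite (coeff_vectors N n)"
  by (simp add: coeff_vectors_def finite_PiE)

lemma card_coeff_vectors: "card (coeff_vectors N n) = nat N ^ n"
  by (simp add: coeff_vectors_def card_PiE)

text \<open>Bezout gives \<open>b\<close> whose inner product with \<open>y\<close> is
  \<open>d\<close> modulo \<open>N\<close>. Translating the solution set by s b, for s below N / d,
  changes the inner product to s d, so the N / d translates are disjoint subsets of the N^n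
  coefficient vectors.\<close>

lemma card_orthogonal_mod:
  fixes y :: "nat \<Rightarrow> int" and n :: nat
  assumes "N > 0"
  defines "d \<equiv> gcd N (Gcd (y ` {..<n}))"
  shows "real (card {a \<in> coeff_vectors N n. N dvd (\<Sum>i<n. a i * y i)}) \<le> of_int N ^ n * of_int d / of_int N"
proof -
  let ?F = "{a \<in> coeff_vectors N n. N dvd (\<Sum>i<n. a i * y i)}"
  obtain c where c: "(\<Sum>i<n. c i * y i) = Gcd (y ` {..<n})"
    using bezout_Gcd_family by blast
  obtain u v where uv: "u * N + v * Gcd (y ` {..<n}) = d"
    unfolding d_def using bezout_int by blast
  define b where "b = (\<lambda>i. v * c i)"
  have b: "(\<Sum>i<n. b i * y i) = d - u * N"
    using uv c by (simp add: b_def mult.assoc flip: sum_distrib_left)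
  have d: "d > 0" "d dvd N" using assms by (auto simp: d_def)
  define h where "h = (\<lambda>(s, a). \<lambda>i\<in>{..<n}. (a i + s * b i) mod N)"
  have h_sum: "(\<Sum>i<n. h (s, a) i * y i) mod N = s * d"
    if s: "s \<in> {0..<N div d}" and a: "a \<in> ?F" for s a
  proof -
    have "(\<Sum>i<n. h (s, a) i * y i) mod N = (\<Sum>i<n. (h (s, a) i * y i) mod N) mod N"
      by (simp add: mod_sum_eq)
    also have "\<dots> = (\<Sum>i<n. ((a i + s * b i) * y i) mod N) mod N"
      by (simp add: h_def mod_mult_left_eq)
    also have "\<dots> = (\<Sum>i<n. (a i + s * b i) * y i) mod N"
      by (simp add: mod_sum_eq)
    also have "(\<Sum>i<n. (a i + s * b i) * y i) = (\<Sum>i<n. a i * y i) + s * (d - u * N)"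
      by (simp add: distrib_right sum.distrib mult.assoc b flip: sum_distrib_left)
    also have "\<dots> mod N = (s * d) mod N"
    proof -
      obtain k where "(\<Sum>i<n. a i * y i) = N * k" using a by (auto elim: dvdE)
      then have "(\<Sum>i<n. a i * y i) + s * (d - u * N) = s * d + N * (k - s * u)"
        by (simp add: algebra_simps)
      then show ?thesis by (simp only: mod_mult_self2)
    qed
    also have "\<dots> = s * d"
    proof (rule mod_pos_pos_trivial)
      have "s * d < (N div d) * d" using s d by (intro mult_strict_right_mono) auto
      then show "s * d < N" using d by simp
    qed (use s d in auto)
    finally show ?thesis .
  qed
  have inj: "inj_on h ({0..<N div d} \<times> ?F)"
  proof (rule inj_onI, clarify)
    fix s a s' a'
    assume *: "s \<in> {0..<N div d}" "s' \<in> {0..<N div d}" "h (s, a) = h (s', a')"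
      and a: "a \<in> coeff_vectors N n" "N dvd (\<Sum>i<n. a i * y i)"
      and a': "a' \<in> coeff_vectors N n" "N dvd (\<Sum>i<n. a' i * y i)"
    have "(\<Sum>i<n. h (s, a) i * y i) mod N = s * d" "(\<Sum>i<n. h (s', a') i * y i) mod N = s' * d"
      by (rule h_sum; use * a a' in simp)+
    then have "s * d = s' * d"
      unfolding *(3) by (rule trans[OF sym])
    then have s: "s = s'" using d by simp
    have "a i = a' i" if "i < n" for i
    proof -
      have "(a i + s * b i) mod N = (a' i + s * b i) mod N"
        using fun_cong[OF *(3), of i] that s by (simp add: h_def)
      then have "[a i + s * b i = a' i + s * b i] (mod N)" by (simp add: cong_def)
      then have "[a i = a' i] (mod N)" by (simp add: cong_add_rcancel)
      moreover have "a i \<in> {0..<N}" "a' i \<in> {0..<N}"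
        using PiE_mem[OF a(1)[unfolded coeff_vectors_def], of i]
          PiE_mem[OF a'(1)[unfolded coeff_vectors_def], of i] that by simp_all
      ultimately show ?thesis by (simp add: cong_def)
    qed
    then have "a = a'"
      by (intro PiE_ext[OF a(1)[unfolded coeff_vectors_def] a'(1)[unfolded coeff_vectors_def]]) simp
    with s show "s = s' \<and> a = a'" by simp
  qed
  have "h ` ({0..<N div d} \<times> ?F) \<subseteq> coeff_vectors N n"
  proof (rule image_subsetI)
    fix p
    show "h p \<in> coeff_vectors N n"
      using assms(1) unfolding coeff_vectors_def by (cases p) (simp add: h_def restrict_PiE_iff)
  qed
  from card_mono[OF finite_coeff_vectors this] have "nat (N div d) * card ?F \<le> nat N ^ n"
    by (simp add: card_image[OF inj] card_cartesian_product card_coeff_vectors)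
  then have "real (nat (N div d) * card ?F) \<le> real (nat N ^ n)"
    by (simp only: of_nat_le_iff)
  moreover have "real (nat (N div d)) = of_int N / of_int d"
    using d assms(1) by (simp add: real_of_int_div pos_imp_zdiv_nonneg_iff)
  ultimately have "of_int N / of_int d * real (card ?F) \<le> of_int N ^ n"
    using assms(1) by simp
  then show ?thesis using d assms(1) by (simp add: field_simps)
qed

lemma sum_inverse_squares_le_2: "(\<Sum>d\<in>{1..m::nat}. 1 / (real d)\<^sup>2) \<le> 2"
proof -
  \<comment> \<open>The sharper bound with - 1/m lets the induction telescope.\<close>
  have "(\<Sum>d\<in>{1..m}. 1 / (real d)\<^sup>2) \<le> 2 - 1 / real m" if "m \<ge> 1" for m
    using that
  proof (induction m rule: nat_induct_at_least)
    case (Suc m)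
    have "1 / (real (Suc m))\<^sup>2 \<le> 1 / (real m * real (Suc m))"
      using Suc.hyps by (intro divide_left_mono) (auto simp: power2_eq_square)
    also have "\<dots> = 1 / real m - 1 / real (Suc m)"
      using Suc.hyps by (simp add: field_simps)
    finally have "1 / (real (Suc m))\<^sup>2 \<le> 1 / real m - 1 / real (Suc m)" .
    then show ?case using Suc.IH by simp
  qed simp
  note bound = this
  show ?thesis
  proof (cases "m \<ge> 1")
    case True
    have "0 \<le> 1 / real m" by simp
    with bound[OF True] show ?thesis by linarith
  next
    case False
    then have "{1..m} = {}" by simp
    then show ?thesis by simp
  qed
qed

text \<open>Each coordinate has at most 2 q + 1 choices with q = B div d, and q \<ge> 1 turns this
  into 3 q.\<close>

lemma card_multiples_box:
  fixes B :: nat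
  assumes "d \<ge> 1" "d \<le> B"
  shows "real (card ({..<n} \<rightarrow>\<^sub>E {t. \<bar>t\<bar> \<le> int B \<and> int d dvd t})) \<le> (3 * real B / real d) ^ n"
proof -
  let ?q = "int (B div d)"
  have sub: "{t. \<bar>t\<bar> \<le> int B \<and> int d dvd t} \<subseteq> (\<lambda>s. int d * s) ` {-?q..?q}"
  proof
    fix t assume "t \<in> {t. \<bar>t\<bar> \<le> int B \<and> int d dvd t}"
    then obtain s where t: "t = int d * s" and "\<bar>int d * s\<bar> \<le> int B" by (auto elim: dvdE)
    then have "int d * \<bar>s\<bar> \<le> int B" by (simp add: abs_mult)
    then have "\<bar>s\<bar> \<le> ?q"
      using zdiv_mono1[of "int d * \<bar>s\<bar>" "int B" "int d"] assms by (simp add: zdiv_int)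
    then have "s \<in> {-?q..?q}"
      unfolding atLeastAtMost_iff by linarith
    then show "t \<in> (\<lambda>s. int d * s) ` {-?q..?q}"
      unfolding t by (rule imageI)
  qed
  have "card {t. \<bar>t\<bar> \<le> int B \<and> int d dvd t} \<le> card ((\<lambda>s. int d * s) ` {-?q..?q})"
    by (rule card_mono[OF _ sub]) simp
  also have "\<dots> \<le> card {-?q..?q}" by (rule card_image_le) simp
  also have "\<dots> \<le> 3 * (B div d)"
    using div_le_mono[OF assms(2), of d] assms(1) by simp
  finally have "real (card {t. \<bar>t\<bar> \<le> int B \<and> int d dvd t}) \<le> 3 * real (B div d)"
    by linarith
  also have "\<dots> \<le> 3 * (real B / real d)"
    by (intro mult_left_mono of_nat_div_le_of_nat) auto
  finally show ?thesis
    by (simp add: card_PiE power_mono)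
qed

text \<open>The gcd is at most the sum of all d \<le> B dividing every entry of y, being one of
  them. After exchanging the sums, counting multiples leaves the factor d^(1-n), which is at most
  d^(-2) because n \<ge> 3.\<close>

lemma sum_gcd_box_le:
  fixes B n :: nat and N :: int
  assumes "n \<ge> 3"
  shows "(\<Sum>y\<in>{y \<in> {..<n} \<rightarrow>\<^sub>E {- int B..int B}. \<exists>i<n. y i \<noteq> 0}. real_of_int (gcd N (Gcd (y ` {..<n}))))
    \<le> 2 * (3 * real B) ^ n"
proof -
  let ?Y = "{y \<in> {..<n} \<rightarrow>\<^sub>E {- int B..int B}. \<exists>i<n. y i \<noteq> 0}"
  let ?P = "\<lambda>d y. \<forall>i<n. int d dvd y i"
  have fin: "finite ?Y" by (intro finite_Collect_conjI disjI1) (auto intro!: finite_PiE)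
  have "(\<Sum>y\<in>?Y. real_of_int (gcd N (Gcd (y ` {..<n}))))
      \<le> (\<Sum>y\<in>?Y. \<Sum>d\<in>{1..B}. if ?P d y then real d else 0)"
  proof (intro sum_mono)
    fix y assume y: "y \<in> ?Y"
    then obtain i where i: "i < n" "y i \<noteq> 0" by blast
    define g where "g = gcd N (Gcd (y ` {..<n}))"
    have dvd: "g dvd y j" if "j < n" for j
      unfolding g_def using that by (meson Gcd_dvd dvd_trans gcd_dvd2 imageI lessThan_iff)
    have "g \<ge> 0" by (simp add: g_def)
    moreover have "g \<noteq> 0" using dvd[OF i(1)] i(2) by auto
    ultimately have g1: "g \<ge> 1" by simp
    have "\<bar>g\<bar> \<le> \<bar>y i\<bar>" using dvd[OF i(1)] i(2) by (rule dvd_imp_le_int[rotated])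
    moreover have "y i \<in> {- int B..int B}"
      using y i(1) by (intro PiE_mem[of y "{..<n}"]) auto
    ultimately have "g \<le> int B" using g1 by auto
    have "real_of_int g = (\<Sum>d\<in>{nat g}. if ?P d y then real d else 0)"
      using g1 dvd by simp
    also have "\<dots> \<le> (\<Sum>d\<in>{1..B}. if ?P d y then real d else 0)"
      by (rule sum_mono2) (use g1 \<open>g \<le> int B\<close> in auto)
    finally show "real_of_int (gcd N (Gcd (y ` {..<n}))) \<le> (\<Sum>d\<in>{1..B}. if ?P d y then real d else 0)"
      by (simp add: g_def)
  qed
  also have "\<dots> = (\<Sum>d\<in>{1..B}. \<Sum>y\<in>?Y. if ?P d y then real d else 0)"
    by (rule sum.swap)
  also have "\<dots> = (\<Sum>d\<in>{1..B}. real d * real (card {y \<in> ?Y. ?P d y}))"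
    by (intro sum.cong refl, subst sum.inter_filter[symmetric, OF fin]) simp
  also have "\<dots> \<le> (\<Sum>d\<in>{1..B}. real d * (3 * real B / real d) ^ n)"
  proof (intro sum_mono mult_left_mono)
    fix d assume d: "d \<in> {1..B}"
    have "{y \<in> ?Y. ?P d y} \<subseteq> {..<n} \<rightarrow>\<^sub>E {t. \<bar>t\<bar> \<le> int B \<and> int d dvd t}"
    proof (intro subsetI PiE_I)
      fix y i assume y: "y \<in> {y \<in> ?Y. ?P d y}"
      then have yP: "y \<in> {..<n} \<rightarrow>\<^sub>E {- int B..int B}" by blast
      show "y i = undefined" if "i \<notin> {..<n}"
        using yP that by (rule PiE_arb)
      show "y i \<in> {t. \<bar>t\<bar> \<le> int B \<and> int d dvd t}" if i: "i \<in> {..<n}"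
      proof -
        have "y i \<in> {- int B..int B}" using yP i by (rule PiE_mem)
        then have "\<bar>y i\<bar> \<le> int B" unfolding atLeastAtMost_iff by linarith
        then show ?thesis using y i by simp
      qed
    qed
    moreover have "finite {t. \<bar>t\<bar> \<le> int B \<and> int d dvd t}"
      by (rule finite_subset[of _ "{- int B..int B}"]) auto
    ultimately have "card {y \<in> ?Y. ?P d y} \<le> card ({..<n} \<rightarrow>\<^sub>E {t. \<bar>t\<bar> \<le> int B \<and> int d dvd t})"
      by (intro card_mono finite_PiE) auto
    also have "real \<dots> \<le> (3 * real B / real d) ^ n"
      using d by (intro card_multiples_box) auto
    finally show "real (card {y \<in> ?Y. ?P d y}) \<le> (3 * real B / real d) ^ n" by simp
  qed simp
  also have "\<dots> \<le> (\<Sum>d\<in>{1..B}. (3 * real B) ^ n * (1 / (real d)\<^sup>2))"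
  proof (intro sum_mono)
    fix d assume d: "d \<in> {1..B}"
    have "(real d) ^ 3 \<le> real d ^ n"
      using d assms by (intro power_increasing) auto
    then have "real d / real d ^ n \<le> real d / real d ^ 3"
      using d by (intro divide_left_mono) auto
    also have "\<dots> = 1 / (real d)\<^sup>2"
      using d by (simp add: power2_eq_square power3_eq_cube)
    finally have "(3 * real B) ^ n * (real d / real d ^ n) \<le> (3 * real B) ^ n * (1 / (real d)\<^sup>2)"
      by (intro mult_left_mono) auto
    then show "real d * (3 * real B / real d) ^ n \<le> (3 * real B) ^ n * (1 / (real d)\<^sup>2)"
      by (simp add: power_divide mult_ac)
  qed
  also have "\<dots> = (3 * real B) ^ n * (\<Sum>d\<in>{1..B}. 1 / (real d)\<^sup>2)"
    by (rule sum_distrib_left[symmetric])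
  also have "\<dots> \<le> (3 * real B) ^ n * 2"
    by (intro mult_left_mono sum_inverse_squares_le_2) auto
  finally show ?thesis by (simp add: mult.commute)
qed

lemma card_short_orthogonal_le:
  fixes B n :: nat and N :: int
  assumes "n \<ge> 3" "N > 0"
  shows "real (card {a \<in> coeff_vectors N n. \<exists>y. (\<exists>i<n. y i \<noteq> 0) \<and> (\<forall>i<n. \<bar>y i\<bar> \<le> int B) \<and>
      N dvd (\<Sum>i<n. a i * y i)}) \<le> of_int N ^ n / of_int N * (2 * (3 * real B) ^ n)" (is "real (card ?Bad) \<le> _")
proof -
  let ?Y = "{y \<in> {..<n} \<rightarrow>\<^sub>E {- int B..int B}. \<exists>i<n. y i \<noteq> 0}"
  let ?F = "\<lambda>y. {a \<in> coeff_vectors N n. N dvd (\<Sum>i<n. a i * y i)}"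
  have fin: "finite ?Y" by (intro finite_Collect_conjI disjI1) (auto intro!: finite_PiE)
  have "?Bad \<subseteq> (\<Union>y\<in>?Y. ?F y)"
  proof clarify
    fix a y i assume a: "a \<in> coeff_vectors N n" "\<forall>i<n. \<bar>y i\<bar> \<le> int B" "N dvd (\<Sum>i<n. a i * y i)"
      and i: "i < n" "y i \<noteq> 0"
    \<comment> \<open>Only entries below \<open>n\<close> matter, and restricting to them puts y
      into the finite box.\<close>
    have "restrict y {..<n} \<in> ?Y" using a i by (auto simp: abs_le_iff)
    moreover have "a \<in> ?F (restrict y {..<n})" using a by simp
    ultimately show "a \<in> (\<Union>y\<in>?Y. ?F y)" by blast
  qed
  then have "card ?Bad \<le> card (\<Union>y\<in>?Y. ?F y)"
    by (rule card_mono[rotated]) (use fin finite_coeff_vectors in auto)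
  also have "\<dots> \<le> (\<Sum>y\<in>?Y. card (?F y))"
    by (rule card_UN_le[OF fin])
  finally have "real (card ?Bad) \<le> (\<Sum>y\<in>?Y. real (card (?F y)))"
    by (simp only: of_nat_le_iff flip: of_nat_sum)
  also have "\<dots> \<le> (\<Sum>y\<in>?Y. of_int N ^ n * of_int (gcd N (Gcd (y ` {..<n}))) / of_int N)"
    by (intro sum_mono card_orthogonal_mod assms)
  also have "\<dots> = of_int N ^ n / of_int N * (\<Sum>y\<in>?Y. of_int (gcd N (Gcd (y ` {..<n}))))"
    by (simp add: sum_distrib_left)
  also have "\<dots> \<le> of_int N ^ n / of_int N * (2 * (3 * real B) ^ n)"
    using assms by (intro mult_left_mono sum_gcd_box_le) auto
  finally show ?thesis .
qed

section \<open>Success of the algorithm\<close>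

text \<open>The transference bound yields a short lattice vector \<open>y\<close> with a nonzero
  coordinate at some \<open>j\<close> \<ge> n - 1. Reducedness then makes the first \<open>n\<close>
  basis vectors shorter than N / \<mu>^n, sorting preserves this bound, and so the chosen vectors
  span the rational span of the family.\<close>

lemma algII_succeeds_if_dual_long:
  fixes v :: "nat \<Rightarrow> int ^ 'm" and R :: int and r :: real
  assumes "\<mu> \<ge> 1" and "CARD('m) > n" and "n \<ge> 3" and "N > 1"
    and \<delta>: "1 / 4 < \<delta>" "\<delta> < 1" and c: "c = inverse (\<delta> - 1 / 4)"
    and v: "v \<in> Omega_families N n \<mu>"
    and r: "r > 0" "r\<^sup>2 = real n ^ 4 * \<mu> ^ (2 * n + 4) * c ^ CARD('m)" "r < of_int R"
    and sep: "\<And>y. \<exists>i<n. y i \<noteq> 0 \<Longrightarrow> N dvd (\<Sum>i<n. a i * y i) \<Longrightarrow> \<exists>i<n. R \<le> \<bar>y i\<bar>"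
  shows "algII_succeeds \<delta> N n v (hidden_vec N n v a)"
  unfolding algII_succeeds_def
proof
  let ?m = "CARD('m)"
  let ?L = "congruence_lattice N (hidden_vec N n v a)"
  fix M assume "M \<in> algII_outputs \<delta> N n (hidden_vec N n v a)"
  then obtain u :: "nat \<Rightarrow> int ^ 'm" and p where M: "M = lattice_completion (lattice_gen n (u \<circ> p))"
    and red: "lll_reduced_basis \<delta> u ?L"
    and p: "p permutes {..<?m}"
    and mono: "mono_on {..<?m} (\<lambda>i. norm (real_vec (u (p i))))"
    by (auto simp: algII_outputs_def)
  have gen: "lattice_gen ?m u = ?L" and ind_u: "int_independent ?m u"
    and lll: "lll_reduced \<delta> ?m (\<lambda>i. real_vec (u i))"
    using red by (auto simp: lll_reduced_basis_def lattice_basis_def int_independent_def)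
  have size: "family_size n v \<le> \<mu>" and "lin_indep_mod N n v"
    using v by (auto simp: Omega_families_def)
  then have ind_v: "int_independent n v"
    using \<open>N > 1\<close> by (intro lin_indep_mod_imp_int_independent)
  have "\<exists>b. N *s v i = (\<Sum>j<?m. b j *s u j)" for i
  proof -
    have "N *s v i \<in> ?L"
      by (auto simp: congruence_lattice_def cong_def intro!: exI[of _ 0])
    then show ?thesis unfolding gen[symmetric] by (auto simp: lattice_gen_def)
  qed
  then obtain B where B: "\<And>i. N *s v i = (\<Sum>j<?m. B i j *s u j)" by metis
  obtain i0 j where j: "i0 < n" "j < ?m" "n - 1 \<le> j" "B i0 j \<noteq> 0"
    using exists_nonzero_coordinate_ge[OF ind_v, where N = N and m = "?m" and B = B and u = u] B \<open>N > 1\<close> \<open>n \<ge> 3\<close> by auto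
  \<comment> \<open>Since R > r and n^2 > 5, this exceeds the threshold of the transference
    bound.\<close>
  define T where "T = real n ^ 3 * (of_int N)\<^sup>2 / r\<^sup>2"
  have "5 * real n * (of_int N)\<^sup>2 / (of_int R)\<^sup>2 < T"
  proof -
    have "r\<^sup>2 \<le> (of_int R)\<^sup>2" using r(1,3) by (intro power_mono) auto
    then have "5 * real n * (of_int N)\<^sup>2 / (of_int R)\<^sup>2 \<le> 5 * real n * (of_int N)\<^sup>2 / r\<^sup>2"
      using r(1,3) by (intro divide_left_mono) auto
    also have "\<dots> < real n ^ 3 * (of_int N)\<^sup>2 / r\<^sup>2"
    proof (intro divide_strict_right_mono mult_strict_right_mono)
      have "3 * 3 \<le> real n * real n" using \<open>n \<ge> 3\<close> by (intro mult_mono) auto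
      then have "5 * real n < (real n * real n) * real n"
        using \<open>n \<ge> 3\<close> by (intro mult_strict_right_mono) auto
      then show "5 * real n < real n ^ 3" by (simp add: power3_eq_cube)
    qed (use r(1) \<open>N > 1\<close> in auto)
    finally show ?thesis by (simp add: T_def)
  qed
  note T_large = this
  have "R > 0" using r(1,3) by linarith
  have "\<exists>k x. (\<forall>i<n. [x i = k * a i] (mod N)) \<and> (\<Sum>i<n. x i * B i j) \<noteq> 0 \<and>
      of_int (\<Sum>i<n. (x i)\<^sup>2) \<le> T"
  proof (rule short_vector_off_hyperplane[OF _ \<open>R > 0\<close> _ _ T_large])
    show "\<exists>i<n. R \<le> \<bar>y i\<bar>" if "\<exists>i<n. y i \<noteq> 0" "N dvd (\<Sum>i<n. a i * y i)" for y
      using that by (rule sep)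
  qed (use j \<open>N > 1\<close> in auto)
  then obtain k x where x: "\<And>i. i < n \<Longrightarrow> [x i = k * a i] (mod N)"
    "(\<Sum>i<n. x i * B i j) \<noteq> 0" "of_int (\<Sum>i<n. (x i)\<^sup>2) \<le> T"
    by blast
  define y where "y = (\<Sum>i<n. x i *s v i)"
  have "y \<in> ?L" unfolding y_def by (rule congruence_lattice_combination[OF x(1)])
  then obtain s where s: "y = (\<Sum>l<?m. s l *s u l)"
    unfolding gen[symmetric] by (auto simp: lattice_gen_def)
  \<comment> \<open>Coordinates in the basis \<open>u\<close> are unique, so N s_j is the inner
    product of x with column \<open>j\<close> of \<open>B\<close>, which is nonzero by the choice of
    x.\<close>
  have "s j \<noteq> 0"
  proof
    assume "s j = 0"
    have "(\<Sum>l<?m. (N * s l - (\<Sum>i<n. x i * B i l)) *s u l)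
        = N *s (\<Sum>l<?m. s l *s u l) - (\<Sum>l<?m. \<Sum>i<n. (x i * B i l) *s u l)"
      by (simp add: Finite_Cartesian_Product.vec_eq_iff left_diff_distrib sum_subtractf
          sum_distrib_left sum_distrib_right mult_ac)
    also have "(\<Sum>l<?m. \<Sum>i<n. (x i * B i l) *s u l) = (\<Sum>i<n. \<Sum>l<?m. (x i * B i l) *s u l)"
      by (rule sum.swap)
    also have "\<dots> = (\<Sum>i<n. x i *s (\<Sum>l<?m. B i l *s u l))"
      by (simp add: Finite_Cartesian_Product.vec_eq_iff sum_distrib_left mult_ac)
    also have "\<dots> = (\<Sum>i<n. x i *s (N *s v i))" by (simp only: B)
    also have "\<dots> = N *s y"
      by (simp add: y_def Finite_Cartesian_Product.vec_eq_iff sum_distrib_left mult_ac)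
    finally have "(\<Sum>l<?m. (N * s l - (\<Sum>i<n. x i * B i l)) *s u l) = 0"
      by (simp flip: s)
    then have "N * s j - (\<Sum>i<n. x i * B i j) = 0"
      using ind_u[unfolded int_independent_def, THEN spec, of "\<lambda>l. N * s l - (\<Sum>i<n. x i * B i l)"] j(2)
      by blast
    with \<open>s j = 0\<close> x(2) show False by simp
  qed
  have c1: "c > 1" using \<delta> unfolding c by (simp add: field_simps)
  have first_short: "(norm (real_vec (u l)) * \<mu> ^ n)\<^sup>2 < (of_int N)\<^sup>2" if "l < n" for l
  proof -
    have "(norm (real_vec (u l)))\<^sup>2 \<le> c ^ (?m - 1) * (norm (\<Sum>l<?m. of_int (s l) *\<^sub>R real_vec (u l)))\<^sup>2"
      using that j by (intro lll_norm_le_norm_combination[OF lll \<delta> c, of j]) (auto simp: \<open>s j \<noteq> 0\<close>)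
    also have "(\<Sum>l<?m. of_int (s l) *\<^sub>R real_vec (u l)) = real_vec y"
      by (simp add: s real_vec_sum real_vec_smult)
    also have "(norm (real_vec y))\<^sup>2 \<le> of_int (\<Sum>i<n. (x i)\<^sup>2) * (real n * \<mu>\<^sup>2)"
      unfolding y_def using size \<open>n \<ge> 3\<close> by (intro norm_combination_sq_le) auto
    also have "\<dots> \<le> T * (real n * \<mu>\<^sup>2)"
      by (intro mult_right_mono x(3)) auto
    finally have "(norm (real_vec (u l)))\<^sup>2 \<le> c ^ (?m - 1) * (T * (real n * \<mu>\<^sup>2))"
      using c1 by (simp add: mult_left_mono)
    then have "(norm (real_vec (u l)))\<^sup>2 * (\<mu> ^ n)\<^sup>2 \<le> c ^ (?m - 1) * (T * (real n * \<mu>\<^sup>2)) * (\<mu> ^ n)\<^sup>2"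
      by (intro mult_right_mono) auto
    \<comment> \<open>The value of \<open>r\<close> is made for this cancellation; the spare factor
      c \<mu>^2 > 1 yields the strict inequality.\<close>
    also have "\<dots> = (of_int N)\<^sup>2 / (c * \<mu>\<^sup>2)"
    proof -
      have "c ^ ?m = c * c ^ (?m - 1)" using \<open>CARD('m) > n\<close> by (subst power_eq_if) auto
      moreover have "\<mu> ^ (2 * n + 4) = (\<mu> ^ n)\<^sup>2 * \<mu>\<^sup>2 * \<mu>\<^sup>2"
        unfolding mult_2 power_add by (simp add: power4_eq_xxxx power2_eq_square mult_ac)
      ultimately have r2: "r\<^sup>2 = real n ^ 4 * ((\<mu> ^ n)\<^sup>2 * \<mu>\<^sup>2 * \<mu>\<^sup>2) * (c * c ^ (?m - 1))"
        using r(2) by simp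
      have "real n > 0" "\<mu> > 0" "c > 0" using assms c1 by auto
      then show ?thesis
        unfolding T_def r2 by (simp add: field_simps power3_eq_cube power4_eq_xxxx)
    qed
    also have "\<dots> < (of_int N)\<^sup>2"
    proof -
      have "1 < c * \<mu>\<^sup>2"
      proof -
        have "1 \<le> \<mu>\<^sup>2" using \<open>\<mu> \<ge> 1\<close> by (rule one_le_power)
        then have "c * 1 \<le> c * \<mu>\<^sup>2" using c1 by (intro mult_left_mono) auto
        with c1 show ?thesis by linarith
      qed
      then show ?thesis using \<open>N > 1\<close> by (simp add: divide_less_eq)
    qed
    finally show ?thesis by (simp add: power_mult_distrib)
  qed
  have in_span: "rat_vec ((u \<circ> p) i) \<in> vec.span ((\<lambda>i. rat_vec (v i)) ` {..<n})" if i: "i < n" for i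
  proof -
    \<comment> \<open>Pigeonhole: the positions from \<open>i\<close> on number m - i > m - n, so
      one of them holds a basis vector of original index below \<open>n\<close>; by sorting, the
      vector at position \<open>i\<close> is no longer than that one.\<close>
    have "\<exists>l\<in>p ` {i..<?m}. l < n"
    proof (rule ccontr)
      assume none: "\<not> ?thesis"
      have sub: "p ` {i..<?m} \<subseteq> {n..<?m}"
      proof (rule image_subsetI)
        fix q assume q: "q \<in> {i..<?m}"
        then have "p q < ?m" using permutes_in_image[OF p, of q] by simp
        moreover have "\<not> p q < n" using none q by blast
        ultimately show "p q \<in> {n..<?m}" by simp
      qed
      have "card (p ` {i..<?m}) \<le> card {n..<?m}" by (rule card_mono[OF _ sub]) simp
      moreover have "card (p ` {i..<?m}) = ?m - i"
        by (subst card_image) (auto intro: inj_on_subset[OF permutes_inj[OF p]])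
      ultimately show False using i \<open>CARD('m) > n\<close> by simp
    qed
    then obtain q where q: "i \<le> q" "q < ?m" "p q < n" by auto
    have "norm (real_vec (u (p i))) \<le> norm (real_vec (u (p q)))"
      using q by (intro mono_onD[OF mono]) auto
    then have "(norm (real_vec (u (p i))) * \<mu> ^ n)\<^sup>2 \<le> (norm (real_vec (u (p q))) * \<mu> ^ n)\<^sup>2"
      using \<open>\<mu> \<ge> 1\<close> by (intro power_mono mult_right_mono) auto
    also have "\<dots> < (of_int N)\<^sup>2" by (rule first_short[OF q(3)])
    finally have short: "norm (real_vec (u (p i))) * \<mu> ^ n < of_int N"
      by (rule power2_less_imp_less) (use \<open>N > 1\<close> in simp)
    have "p i < ?m" using permutes_in_image[OF p, of i] i \<open>CARD('m) > n\<close> by simp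
    then have "u (p i) \<in> ?L"
      unfolding gen[symmetric] by (rule lattice_gen_generator)
    then obtain t where "\<And>j. [u (p i) $ j = (\<Sum>i<n. (t * a i) * v i $ j)] (mod N)"
      using congruence_lattice_cong by blast
    from short_vector_in_span[OF ind_v _ _ size this short] show ?thesis
      using \<open>n \<ge> 3\<close> \<open>N > 1\<close> by simp
  qed
  have "int_independent n (u \<circ> p)"
    using \<open>CARD('m) > n\<close> by (intro int_independent_permute[OF ind_u p]) simp
  then show "M = lattice_completion (lattice_gen n v)"
    unfolding M by (intro span_eq_of_independent_subset ind_v in_span)
qed

text \<open>Transfers the count of coefficient vectors to the count of distinct hidden lattice
  problems.\<close>

lemma inj_on_hidden_vec:
  assumes "lin_indep_mod N n v"
  shows "inj_on (hidden_vec N n v) (coeff_vectors N n)"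
proof (rule inj_onI)
  fix a a' assume a: "a \<in> coeff_vectors N n" and a': "a' \<in> coeff_vectors N n"
    and eq: "hidden_vec N n v a = hidden_vec N n v a'"
  have "[(\<Sum>i<n. (a i - a' i) * v i $ j) = 0] (mod N)" for j
  proof -
    have "(\<Sum>i<n. a i * v i $ j) mod N = (\<Sum>i<n. a' i * v i $ j) mod N"
      using arg_cong[OF eq, of "\<lambda>w. w $ j"] by (simp add: hidden_vec_def)
    then have "N dvd (\<Sum>i<n. a i * v i $ j) - (\<Sum>i<n. a' i * v i $ j)"
      by (simp add: mod_eq_dvd_iff)
    then show ?thesis by (simp add: cong_0_iff left_diff_distrib sum_subtractf)
  qed
  then have *: "[a i - a' i = 0] (mod N)" if "i < n" for i
    using assms[unfolded lin_indep_mod_def, THEN spec, of "\<lambda>i. a i - a' i"] that by blast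
  show "a = a'"
  proof (rule PiE_ext[OF a[unfolded coeff_vectors_def] a'[unfolded coeff_vectors_def]])
    fix i assume i: "i \<in> {..<n}"
    have "a i \<in> {0..<N}" "a' i \<in> {0..<N}"
      using PiE_mem[OF a[unfolded coeff_vectors_def] i] PiE_mem[OF a'[unfolded coeff_vectors_def] i] .
    moreover have "[a i = a' i] (mod N)"
      using *[of i] i by (simp add: cong_diff_iff_cong_0)
    ultimately show "a i = a' i" by (simp add: cong_def)
  qed
qed

theorem theorem4:
  fixes \<mu> \<delta> c \<epsilon> :: real and N :: int and n :: nat and v :: "nat \<Rightarrow> int ^ 'm"
  assumes "\<mu> \<ge> 1"
    and "CARD('m) > n" and "n \<ge> 3"
    and "N > 0"
    and "1 / 4 < \<delta>" and "\<delta> < 1"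
    and "c = inverse (\<delta> - 1 / 4)"
    and "0 < \<epsilon>" and "\<epsilon> < 1"
    and "log 2 (real_of_int N * \<epsilon>) >
           real CARD('m) * real n / 2 * log 2 c + real n * (real n + 2) * log 2 \<mu>
             + real n * log 2 (3 * (real n)\<^sup>2) + 1"
    and "v \<in> Omega_families N n \<mu>"
  shows "real (card {a \<in> coeff_vectors N n. algII_succeeds \<delta> N n v (hidden_vec N n v a)})
           \<ge> (1 - \<epsilon>) * real_of_int N ^ n \<and>
         real (card {b \<in> hidden_lattice_problems N n v. algII_succeeds \<delta> N n v b})
           \<ge> (1 - \<epsilon>) * real (card (hidden_lattice_problems N n v))"
proof -
  let ?m = "CARD('m)"
  let ?succ = "\<lambda>a. algII_succeeds \<delta> N n v (hidden_vec N n v a)"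
  let ?Good = "{a \<in> coeff_vectors N n. ?succ a}"
  define r where "r = (real n)\<^sup>2 * \<mu> ^ (n + 2) * c powr (real ?m / 2)"
  \<comment> \<open>Integer vectors outside the box of radius \<open>B\<close> have sup norm at
    least B + 1 > r, while B \<le> r keeps the union bound below its value at
    \<open>r\<close>.\<close>
  define B where "B = nat \<lfloor>r\<rfloor>"
  have c1: "c > 1" using assms(5,6) unfolding assms(7) by (simp add: field_simps)
  have "(real n)\<^sup>2 \<ge> 1" using \<open>n \<ge> 3\<close> by (simp add: one_le_power)
  moreover have "\<mu> ^ (n + 2) \<ge> 1" using \<open>\<mu> \<ge> 1\<close> by (rule one_le_power)
  moreover have "c powr (real ?m / 2) \<ge> 1" using c1 by (intro ge_one_powr_ge_zero) auto
  ultimately have "1 * 1 * 1 \<le> r"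
    unfolding r_def by (intro mult_mono) auto
  then have r1: "r \<ge> 1" by simp
  have r2: "r\<^sup>2 = real n ^ 4 * \<mu> ^ (2 * n + 4) * c ^ ?m"
  proof -
    have "(c powr (real ?m / 2))\<^sup>2 = c ^ ?m"
      using c1 by (simp add: power2_eq_square powr_realpow flip: powr_add)
    moreover have "(\<mu> ^ (n + 2))\<^sup>2 = \<mu> ^ (2 * n + 4)"
      unfolding mult_2 power_add by (simp add: power4_eq_xxxx power2_eq_square mult_ac)
    ultimately show ?thesis by (simp add: r_def power_mult_distrib)
  qed
  \<comment> \<open>The logarithmic hypothesis is this inequality: its right-hand side is the base-2
    logarithm of 2 (3 r)^n.\<close>
  have large: "2 * (3 * r) ^ n < of_int N * \<epsilon>"
  proof -
    have "log 2 (3 * r) = log 2 (3 * (real n)\<^sup>2 * \<mu> ^ (n + 2) * c powr (real ?m / 2))"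
      by (simp add: r_def mult.assoc)
    also have "\<dots> = log 2 (3 * (real n)\<^sup>2) + log 2 (\<mu> ^ (n + 2)) + log 2 (c powr (real ?m / 2))"
      using \<open>n \<ge> 3\<close> \<open>\<mu> \<ge> 1\<close> c1 by (subst log_mult; (subst log_mult)?; simp)
    also have "log 2 (\<mu> ^ (n + 2)) = (real n + 2) * log 2 \<mu>"
      using \<open>\<mu> \<ge> 1\<close> by (subst log_nat_power) auto
    also have "log 2 (c powr (real ?m / 2)) = real ?m / 2 * log 2 c"
      using c1 by (subst log_powr) auto
    finally have log_r: "log 2 (3 * r) =
      log 2 (3 * (real n)\<^sup>2) + (real n + 2) * log 2 \<mu> + real ?m / 2 * log 2 c" .
    have "log 2 (2 * (3 * r) ^ n) = 1 + real n * log 2 (3 * r)"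
      using r1 log_mult[of 2 2 "(3 * r) ^ n"] log_nat_power[of "3 * r" 2 n]
      by (simp del: power_mult_distrib)
    then have "log 2 (2 * (3 * r) ^ n) = real ?m * real n / 2 * log 2 c + real n * (real n + 2) * log 2 \<mu>
             + real n * log 2 (3 * (real n)\<^sup>2) + 1"
      unfolding log_r by (simp add: algebra_simps)
    with assms(10) have "log 2 (2 * (3 * r) ^ n) < log 2 (real_of_int N * \<epsilon>)" by simp
    then show ?thesis
      using r1 assms by (subst (asm) log_less_cancel_iff) auto
  qed
  have "N > 1"
  proof -
    have "1 \<le> (3 * r) ^ n" using r1 by (intro one_le_power) simp
    then have "1 < of_int N * \<epsilon>" using large by linarith
    also have "\<dots> \<le> of_int N * 1" using assms by (intro mult_left_mono) auto
    finally show ?thesis by simp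
  qed
  let ?Bad = "{a \<in> coeff_vectors N n. \<exists>y. (\<exists>i<n. y i \<noteq> 0) \<and> (\<forall>i<n. \<bar>y i\<bar> \<le> int B) \<and>
      N dvd (\<Sum>i<n. a i * y i)}"
  have sub: "coeff_vectors N n - ?Bad \<subseteq> ?Good"
  proof
    fix a assume a: "a \<in> coeff_vectors N n - ?Bad"
    have "?succ a"
    proof (rule algII_succeeds_if_dual_long[where r = r and R = "int B + 1"])
      show "r < of_int (int B + 1)"
        using r1 unfolding B_def by linarith
      show "\<exists>i<n. int B + 1 \<le> \<bar>y i\<bar>" if "\<exists>i<n. y i \<noteq> 0" "N dvd (\<Sum>i<n. a i * y i)" for y
      proof (rule ccontr)
        assume "\<not> ?thesis"
        then have "\<forall>i<n. \<bar>y i\<bar> \<le> int B" by (meson linorder_not_le zle_add1_eq_le)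
        then have "a \<in> ?Bad" using a that by blast
        with a show False by blast
      qed
    qed (use assms r1 r2 \<open>N > 1\<close> in auto)
    with a show "a \<in> ?Good" by blast
  qed
  have fin: "finite ?Good" using finite_coeff_vectors by simp
  have "real (card ?Bad) \<le> of_int N ^ n / of_int N * (2 * (3 * real B) ^ n)"
    by (rule card_short_orthogonal_le[OF \<open>n \<ge> 3\<close> \<open>N > 0\<close>])
  also have "\<dots> \<le> of_int N ^ n / of_int N * (of_int N * \<epsilon>)"
  proof (intro mult_left_mono)
    have "real B \<le> r" using r1 unfolding B_def by linarith
    then have "2 * (3 * real B) ^ n \<le> 2 * (3 * r) ^ n"
      by (intro mult_left_mono power_mono) auto
    with large show "2 * (3 * real B) ^ n \<le> of_int N * \<epsilon>" by linarith
  qed (use assms in auto)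
  also have "\<dots> = \<epsilon> * of_int N ^ n" using \<open>N > 0\<close> by simp
  finally have bad: "real (card ?Bad) \<le> \<epsilon> * of_int N ^ n" .
  have card_all: "real (card (coeff_vectors N n)) = of_int N ^ n"
    using \<open>N > 0\<close> by (simp add: card_coeff_vectors)
  have "card (coeff_vectors N n) - card ?Bad \<le> card (coeff_vectors N n - ?Bad)"
    using finite_coeff_vectors by (intro diff_card_le_card_Diff) simp
  also have "\<dots> \<le> card ?Good" by (rule card_mono[OF fin sub])
  finally have "real (card (coeff_vectors N n)) \<le> real (card ?Good) + real (card ?Bad)" by linarith
  with bad have first: "(1 - \<epsilon>) * of_int N ^ n \<le> real (card ?Good)"
    unfolding card_all by (simp add: algebra_simps)
  have inj: "inj_on (hidden_vec N n v) (coeff_vectors N n)"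
    using assms(11) by (intro inj_on_hidden_vec) (simp add: Omega_families_def)
  have "{b \<in> hidden_lattice_problems N n v. algII_succeeds \<delta> N n v b} = hidden_vec N n v ` ?Good"
    by (auto simp: hidden_lattice_problems_def)
  then have "card {b \<in> hidden_lattice_problems N n v. algII_succeeds \<delta> N n v b} = card ?Good"
    using card_image[OF inj_on_subset[OF inj, of ?Good]] by simp
  moreover have "real (card (hidden_lattice_problems N n v)) = of_int N ^ n"
    using card_image[OF inj] card_all by (simp add: hidden_lattice_problems_def)
  ultimately show ?thesis using first by simp
qed

end
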